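(* Assume $Y_i=g(V_i;\theta^* )+W_i$, $i=1,\dots,n$, where $W\sim\mathcal N(\mathbf 0_n,\sigma^2\boldsymbol I_n)$ is independent of $V$. Let $q\in[1,\infty]$, and let $\alpha_1,\alpha_2>0$ with $\alpha_1+\alpha_2=\alpha\in(0,1)$. Let $$r_{\alpha,q}=\frac{\sigma}{R}\sum_{r=1}^{R}\Big\Vert \tfrac1n X^TZ_r\Big\Vert_q+\tau_{\alpha_1,q}+\sqrt{\tfrac1R}\,\tau_{\alpha_2,q},$$ let $(\hat\theta_\alpha,\hat\mu_\alpha)$ be an optimal solution of the program $$\min_{(\theta,\mu)\in\mathbb R^p\times\mathbb R}\mu\quad\text{subject to}\quad \Big\Vert\tfrac1n\sum_{i=1}^nX_i[Y_i-g(V_i;\theta)]\Big\Vert_q\le r_{\alpha,q}+\mu,\quad h(\theta)\in\Omega,\quad \mu\ge0,$$ and let $\Psi_q(\hat\theta_\alpha)=\Big\Vert\tfrac1n\sum_{i=1}^nX_i[Y_i-g(V_i;\hat\theta_\alpha)]\Big\Vert_q$. (Type I error) If $h(\theta^* )\in\Omega$, then $$\mathbb P\{\Psi_q(\hat\theta_\alpha)\ge r_{\alpha,q}\}\le\alpha.$$ (Type II error) Let $\beta_1,\beta_2>0$ with $\beta_1+\beta_2=\beta\in(0,1)$. If $h(\theta^* )\notin\Omega$ and $$\inf_{\theta\in\Theta_0}\Big\Vert\tfrac1n\sum_{i=1}^nX_i[g(V_i;\theta^* )-g(V_i;\theta)]\Big\Vert_q\ge\delta_{\alpha,\beta,q},$$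 where $$\delta_{\alpha,\beta,q}=2\,\mathbb E_W\Big[\Big\Vert\tfrac1nX^TW\Big\Vert_q\Big]+\tau_{\alpha_1,q}+\sqrt{\tfrac1R}\,\tau_{\alpha_2,q}+\sqrt{\tfrac1R}\,\tau_{\beta_1,q}+\tau_{\beta_2,q},$$ then, for the same $r_{\alpha,q}$, $$\mathbb P\{\Psi_q(\hat\theta_\alpha)\le r_{\alpha,q}\}\le\beta.$$
   Context: Setting: $Y=(Y_i)_{i=1}^n$ is the vector of real responses, $V\in\mathbb R^{n\times k}$ is the covariate matrix with rows $V_i$, $\theta^*\in\mathbb R^p$ is an unknown coefficient vector, and $g(\cdot;\cdot)$ is a known real-valued function, possibly nonlinear in $\theta$. There is no restriction on the relative sizes of $p,k,n$. The noise level $\sigma>0$ is known. Everything is conditional on $V$ (i.e. $V$ may be treated as fixed); $\mathbb E_W[\cdot]$ is the expectation over $W$ only, conditional on $V$. $X_i:=f(V_i)\in\mathbb R^L$ for a pre-specified function $f$; $X\in\mathbb R^{n\times L}$ is the matrix with rows $X_i$ and entries $X_{ij}$. $\Vert\cdot\Vert_q$ is the usual $\ell_q$-norm on $\mathbb R^L$. The hypotheses are $H_0: h(\theta^* )\in\Omega$ versus $H_1:h(\theta^* )\notin\Omega$, where $h:\mathbb R^p\to\mathbb R^m$ is a given (possibly nonlinear) function, $\Omega\subseteq\mathbb R^m$ is nonempty and closed, and $\Theta_0:=\{\theta\in\mathbb R^p:h(\theta)\in\Omega\}$ is assumed nonempty. Notation: $\Big\Vert\sqrt{\frac1n\sum_{i=1}^nX_i^2}\Big\Vert_q$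 denotes $\Big(\sum_{j=1}^L\big(\frac1n\sum_{i=1}^nX_{ij}^2\big)^{q/2}\Big)^{1/q}$ for $q\in[1,\infty)$ and $\max_{1\le j\le L}\sqrt{\frac1n\sum_{i=1}^nX_{ij}^2}$ for $q=\infty$. For $\varsigma\in(0,1)$, $$\tau_{\varsigma,q}:=\sigma\Big\Vert\sqrt{\tfrac1n\sum_{i=1}^nX_i^2}\Big\Vert_q\sqrt{\tfrac2n\log\tfrac1\varsigma}.$$ $R\ge1$ is an integer and $Z\in\mathbb R^{n\times R}$ is a matrix, independent of $W$ and $V$, with independent $\mathcal N(0,1)$ entries and columns $Z_1,\dots,Z_R$. Probabilities are over $(W,Z)$.
   Formalization: X ≠ 0 is assumed (for X = 0 both bounds fail). The type I bound is proved for Ψ > r always, and for Ψ ≥ r only if almost surely Ψ(θ̂) = r occurs only when no θ in Θ₀ has Ψ(θ) < r; otherwise an optimal θ̂ with Ψ(θ̂) = r surely refutes it. *)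

theory Defs
  imports "HOL-Probability.Probability"
begin

text \<open>
  The sizes \<open>n\<close>, \<open>k\<close>, \<open>L\<close>, \<open>p\<close>, \<open>m\<close>, \<open>R\<close> are the cardinalities of finite index types, and an
  \<open>a \<times> b\<close> matrix has type \<^typ>\<open>real^'b^'a\<close>. The covariates are fixed, so every probability and
  expectation is conditional on them.
\<close>

text \<open>The \<open>\<ell>\<^sub>q\<close>-norm; it is only meaningful for \<open>1 \<le> q \<le> \<infinity>\<close>.\<close>
definition lq_norm :: "ereal \<Rightarrow> real^'l \<Rightarrow> real" where
  "lq_norm q x =
     (if q = \<infinity> then Max (range (\<lambda>j. \<bar>x $ j\<bar>))
      else (\<Sum>j\<in>UNIV. \<bar>x $ j\<bar> powr real_of_ereal q) powr (1 / real_of_ereal q))"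

text \<open>The Lebesgue density of the normal law with mean \<open>0\<close> and covariance \<open>\<sigma>\<^sup>2 I\<^sub>n\<close>.\<close>
definition iso_normal_density :: "real \<Rightarrow> real^'n \<Rightarrow> real" where
  "iso_normal_density \<sigma> w =
     exp (- (norm w)\<^sup>2 / (2 * \<sigma>\<^sup>2)) / sqrt (2 * pi * \<sigma>\<^sup>2) ^ CARD('n)"

definition feature_matrix :: "(real^'k \<Rightarrow> real^'l) \<Rightarrow> real^'k^'n \<Rightarrow> real^'l^'n" where
  "feature_matrix f V = (\<chi> i. f (V $ i))"

definition col_rms :: "real^'l^'n \<Rightarrow> real^'l" where
  "col_rms X = (\<chi> j. sqrt (1 / real CARD('n) * (\<Sum>i\<in>UNIV. (X $ i $ j)\<^sup>2)))"

definition tau :: "real \<Rightarrow> ereal \<Rightarrow> real^'l^'n \<Rightarrow> real \<Rightarrow> real" where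
  "tau \<sigma> q X s = \<sigma> * lq_norm q (col_rms X) * sqrt (2 / real CARD('n) * ln (1 / s))"

text \<open>The norm of \<open>n\<^sup>-\<^sup>1 X\<^sup>T w\<close>.\<close>
definition score_norm :: "ereal \<Rightarrow> real^'l^'n \<Rightarrow> real^'n \<Rightarrow> real" where
  "score_norm q X w = lq_norm q ((1 / real CARD('n)) *\<^sub>R (transpose X *v w))"

definition crit_r :: "real \<Rightarrow> ereal \<Rightarrow> real^'l^'n \<Rightarrow> real^'r^'n \<Rightarrow> real \<Rightarrow> real \<Rightarrow> real" where
  "crit_r \<sigma> q X Z \<alpha>\<^sub>1 \<alpha>\<^sub>2 =
     \<sigma> / real CARD('r) * (\<Sum>r\<in>UNIV. score_norm q X (column r Z))
     + tau \<sigma> q X \<alpha>\<^sub>1 + sqrt (1 / real CARD('r)) * tau \<sigma> q X \<alpha>\<^sub>2"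

definition Psi :: "ereal \<Rightarrow> (real^'k \<Rightarrow> real^'p \<Rightarrow> real) \<Rightarrow> real^'k^'n \<Rightarrow> real^'l^'n \<Rightarrow> real^'n
    \<Rightarrow> real^'p \<Rightarrow> real" where
  "Psi q g V X y \<theta> =
     lq_norm q ((1 / real CARD('n)) *\<^sub>R (\<Sum>i\<in>UNIV. (y $ i - g (V $ i) \<theta>) *\<^sub>R X $ i))"

definition null_params :: "(real^'p \<Rightarrow> real^'m) \<Rightarrow> (real^'m) set \<Rightarrow> (real^'p) set" where
  "null_params h \<Omega> = {\<theta>. h \<theta> \<in> \<Omega>}"

text \<open>Optimal solutions of the program: minimize \<open>\<mu>\<close> over all pairs \<open>(\<theta>, \<mu>)\<close> satisfying
  \<open>\<Psi> \<theta> \<le> r + \<mu>\<close>, \<open>h \<theta> \<in> \<Omega>\<close> and \<open>\<mu> \<ge> 0\<close>. They need not be unique.\<close>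
definition optimal_solution :: "(real^'p \<Rightarrow> real) \<Rightarrow> real \<Rightarrow> (real^'p \<Rightarrow> real^'m) \<Rightarrow> (real^'m) set
    \<Rightarrow> real^'p \<Rightarrow> real \<Rightarrow> bool" where
  "optimal_solution \<Psi> r h \<Omega> \<theta> \<mu> \<longleftrightarrow>
     is_arg_min snd (\<lambda>(\<theta>, \<mu>). \<Psi> \<theta> \<le> r + \<mu> \<and> h \<theta> \<in> \<Omega> \<and> \<mu> \<ge> 0) (\<theta>, \<mu>)"

text \<open>
  An optimal \<open>\<theta>\<close> with \<open>\<Psi> \<theta> = r\<close> lies exactly on the boundary between acceptance and rejection.
  This predicate says that it does so only when it has to, that is, when no null parameter has
  \<open>\<Psi> < r\<close>. Without it, the bound on the type I error fails for the event \<open>\<Psi> \<theta> \<ge> r\<close>: with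
  \<open>n = L = p = m = 1\<close>, \<open>X = 1\<close>, \<open>g v \<theta> = \<theta>\<close>, \<open>h \<theta> = \<theta>\<close> and \<open>\<Omega> = UNIV\<close>, the pair
  \<open>(Y + r, 0)\<close> is always optimal, and \<open>\<Psi> (Y + r) = r\<close> with probability one.
\<close>
definition no_avoidable_tie :: "(real^'p \<Rightarrow> real) \<Rightarrow> real \<Rightarrow> (real^'p) set \<Rightarrow> real^'p \<Rightarrow> bool" where
  "no_avoidable_tie \<Psi> r \<Theta>\<^sub>0 \<theta> \<longleftrightarrow> (\<Psi> \<theta> = r \<longrightarrow> (\<forall>\<theta>'\<in>\<Theta>\<^sub>0. r \<le> \<Psi> \<theta>'))"

text \<open>The index type \<open>'r\<close> of the simulated columns enters only through \<open>R = CARD('r)\<close>, passed as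
  a number here.\<close>
definition separation :: "'a measure \<Rightarrow> ('a \<Rightarrow> real^'n) \<Rightarrow> real \<Rightarrow> ereal \<Rightarrow> real^'l^'n \<Rightarrow> nat
    \<Rightarrow> real \<Rightarrow> real \<Rightarrow> real \<Rightarrow> real \<Rightarrow> real" where
  "separation M W \<sigma> q X R \<alpha>\<^sub>1 \<alpha>\<^sub>2 \<beta>\<^sub>1 \<beta>\<^sub>2 =
     2 * (\<integral>\<omega>. score_norm q X (W \<omega>) \<partial>M)
     + tau \<sigma> q X \<alpha>\<^sub>1 + sqrt (1 / real R) * tau \<sigma> q X \<alpha>\<^sub>2
     + sqrt (1 / real R) * tau \<sigma> q X \<beta>\<^sub>1 + tau \<sigma> q X \<beta>\<^sub>2"

end

theory Submission
  imports Defs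
begin

text \<open>
  If the null holds, then \<open>(\<theta>\<^sup>*, 0)\<close> is feasible as soon as \<open>\<Psi> \<theta>\<^sup>* \<le> r\<close>, and \<open>\<Psi> \<theta>\<^sup>*\<close> is the norm \<open>S\<close> of
  \<open>n\<^sup>-\<^sup>1 X\<^sup>T W\<close>; under the alternative, the triangle inequality bounds the separation by
  \<open>\<Psi> \<theta> + S\<close>. Either error therefore forces \<open>S\<close>, or the average of \<open>R\<close> simulated copies of it, to
  deviate from the common mean by some \<open>\<tau>\<close>, respectively \<open>R\<^sup>-\<^sup>1\<^sup>/\<^sup>2 \<tau>\<close>, and a union bound remains.

  The deviations are controlled by Gaussian concentration with the sharp constant,
  \<open>E exp (l (f - E f)) \<le> exp (l\<^sup>2 L\<^sup>2 v / 2)\<close> for convex \<open>L\<close>-Lipschitz \<open>f\<close> and variance \<open>v\<close>.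
  The Moreau envelope reduces this to \<open>f\<close> with bounded second differences. Such an \<open>f\<close> is affine
  up to a quadratic error, so that over a small variance \<open>e\<close> the exponential moment is at most
  \<open>1 + l\<^sup>2 L\<^sup>2 e / 2 + C e\<^sup>3\<^sup>/\<^sup>2\<close>, and averaging \<open>f\<close> over a Gaussian preserves the hypotheses with the
  same \<open>C\<close>. Composing \<open>N\<close> steps of variance \<open>v / N\<close> and letting \<open>N \<rightarrow> \<infinity>\<close> gives the bound.
\<close>

section \<open>Isotropic Gaussian measures\<close>

text \<open>\<open>v\<close> is the variance, not the standard deviation. An arbitrary Euclidean
  space is allowed so that the same facts serve vectors in \<open>real^'n\<close> and whole matrices
  in \<open>real^'r^'n\<close>, whose norm is the Frobenius norm.\<close>

definition gauss_density :: "real \<Rightarrow> 'a::euclidean_space \<Rightarrow> real" where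
  "gauss_density v x = exp (- (norm x)\<^sup>2 / (2 * v)) / sqrt (2 * pi * v) ^ DIM('a)"

definition gauss :: "real \<Rightarrow> 'a::euclidean_space measure" where
  "gauss v = density lborel (\<lambda>x. ennreal (gauss_density v x))"

lemma gauss_density_nonneg [simp]: "v > 0 \<Longrightarrow> 0 \<le> gauss_density v x"
  by (simp add: gauss_density_def)

lemma gauss_density_measurable [measurable]: "gauss_density v \<in> borel_measurable borel"
  unfolding gauss_density_def by measurable

lemma space_gauss [simp]: "space (gauss v) = UNIV"
  and sets_gauss [simp, measurable_cong]: "sets (gauss v) = sets borel"
  by (simp_all add: gauss_def)

text \<open>The exponent is a sum over coordinates; \<open>normal_density\<close> takes a standard
  deviation, hence \<open>sqrt v\<close>. The factorization reduces both the total mass and the law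
  of independent coordinates to dimension one.\<close>

lemma gauss_density_prod:
  fixes x :: "'a::euclidean_space"
  assumes "v > 0"
  shows "gauss_density v x = (\<Prod>b\<in>Basis. normal_density 0 (sqrt v) (x \<bullet> b))"
proof -
  have "(norm x)\<^sup>2 = (\<Sum>b\<in>Basis. (x \<bullet> b)\<^sup>2)"
    by (simp add: euclidean_inner[of x x] power2_norm_eq_inner flip: power2_eq_square)
  then have "exp (- (norm x)\<^sup>2 / (2 * v)) = (\<Prod>b\<in>Basis. exp (- (x \<bullet> b)\<^sup>2 / (2 * v)))"
    by (simp add: exp_sum sum_divide_distrib flip: sum_negf)
  moreover have "sqrt (2 * pi * v) ^ DIM('a) = (\<Prod>b\<in>(Basis::'a set). sqrt (2 * pi * v))"
    by simp
  ultimately show ?thesis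
    using assms unfolding gauss_density_def normal_density_def
    by (simp add: prod_dividef)
qed

lemma prob_space_gauss:
  assumes "v > 0"
  shows "prob_space (gauss v :: 'a::euclidean_space measure)"
proof
  have 1: "(\<integral>\<^sup>+x. ennreal (normal_density 0 (sqrt v) x) \<partial>lborel) = 1"
    using assms by (subst nn_integral_eq_integral) auto
  have "emeasure (gauss v) (space (gauss v :: 'a measure)) =
      (\<integral>\<^sup>+x. (\<Prod>b\<in>Basis. ennreal (normal_density 0 (sqrt v) ((x::'a) \<bullet> b))) \<partial>lborel)"
    by (simp add: gauss_def emeasure_density gauss_density_prod assms prod_ennreal)
  also have "\<dots> = 1"
    by (subst nn_integral_lborel_prod) (simp_all add: 1)
  finally show "emeasure (gauss v) (space (gauss v :: 'a measure)) = 1" .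
qed

section \<open>Laws of vectors with independent normal coordinates\<close>

lemma (in prob_space) indep_vars_reindex:
  assumes "inj_on \<iota> J" and X: "indep_vars N X (\<iota> ` J)"
  shows "indep_vars (\<lambda>j. N (\<iota> j)) (\<lambda>j. X (\<iota> j)) J"
  unfolding indep_vars_def2
proof (intro conjI ballI indep_setsI)
  fix j assume "j \<in> J"
  then show "random_variable (N (\<iota> j)) (X (\<iota> j))"
    using X by (simp add: indep_vars_def2)
  then show "{X (\<iota> j) -` A \<inter> space M |A. A \<in> sets (N (\<iota> j))} \<subseteq> events"
    by (auto intro: measurable_sets)
next
  fix A K assume K: "K \<noteq> {}" "K \<subseteq> J" "finite K"
    and A: "\<forall>j\<in>K. A j \<in> {X (\<iota> j) -` A \<inter> space M |A. A \<in> sets (N (\<iota> j))}"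
  have inj: "inj_on \<iota> K"
    using assms(1) K(2) by (rule inj_on_subset)
  \<comment> \<open>Pulling the events back along the inverse of \<iota> gives a family indexed by
    the image of \<open>K\<close>, where the independence of \<open>X\<close> applies.\<close>
  define B where "B = A \<circ> inv_into K \<iota>"
  have B: "B (\<iota> k) = A k" if "k \<in> K" for k
    using that inj by (simp add: B_def)
  have "prob (\<Inter>i\<in>\<iota> ` K. B i) = (\<Prod>i\<in>\<iota> ` K. prob (B i))"
    using X K A B unfolding indep_vars_def2
    by (intro indep_setsD[of _ "\<iota> ` J"]) auto
  then show "prob (\<Inter>j\<in>K. A j) = (\<Prod>j\<in>K. prob (A j))"
    using B by (simp add: prod.reindex[OF inj])
qed

text \<open>By uniqueness of the product measure it suffices to compare the two sides on boxes.
  There the indicator is the product of the coordinate indicators, and Tonelli turns the integral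
  into a product.\<close>

lemma PiM_density_prod:
  fixes f :: "'i \<Rightarrow> 'a \<Rightarrow> ennreal"
  assumes "finite I" and "sigma_finite_measure N" and [measurable]: "\<And>i. i \<in> I \<Longrightarrow> f i \<in> borel_measurable N"
    and "\<And>i. sigma_finite_measure (density N (f i))"
  shows "PiM I (\<lambda>i. density N (f i)) = density (PiM I (\<lambda>_. N)) (\<lambda>x. \<Prod>i\<in>I. f i (x i))"
proof -
  interpret N: product_sigma_finite "\<lambda>_::'i. N"
    using assms(2) by (simp add: product_sigma_finite_def)
  interpret D: product_sigma_finite "\<lambda>i. density N (f i)"
    using assms(4) by (simp add: product_sigma_finite_def)
  have [measurable]: "(\<lambda>x. \<Prod>i\<in>I. f i (x i)) \<in> borel_measurable (PiM I (\<lambda>_. N))"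
    by measurable
  show ?thesis
  proof (rule D.PiM_eqI[symmetric])
    fix A assume A: "\<And>i. i \<in> I \<Longrightarrow> A i \<in> sets (density N (f i))"
    then have A': "\<And>i. i \<in> I \<Longrightarrow> A i \<in> sets N" by simp
    have [measurable]: "Pi\<^sub>E I A \<in> sets (PiM I (\<lambda>_. N))"
      using A' \<open>finite I\<close> by (intro sets_PiM_I_finite) auto
    have "emeasure (density (PiM I (\<lambda>_. N)) (\<lambda>x. \<Prod>i\<in>I. f i (x i))) (Pi\<^sub>E I A) =
        (\<integral>\<^sup>+x. (\<Prod>i\<in>I. f i (x i)) * indicator (Pi\<^sub>E I A) x \<partial>PiM I (\<lambda>_. N))"
      by (rule emeasure_density) auto
    also have "\<dots> = (\<integral>\<^sup>+x. (\<Prod>i\<in>I. f i (x i) * indicator (A i) (x i)) \<partial>PiM I (\<lambda>_. N))"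
      using \<open>finite I\<close>
      by (intro nn_integral_cong)
         (auto simp: prod.distrib indicator_def PiE_iff space_PiM prod_zero_iff)
    also have "\<dots> = (\<Prod>i\<in>I. \<integral>\<^sup>+x. f i x * indicator (A i) x \<partial>N)"
      using \<open>finite I\<close> A' by (intro N.product_nn_integral_prod) auto
    also have "\<dots> = (\<Prod>i\<in>I. emeasure (density N (f i)) (A i))"
      using A' by (intro prod.cong refl emeasure_density[symmetric]) auto
    finally show "emeasure (density (PiM I (\<lambda>_. N)) (\<lambda>x. \<Prod>i\<in>I. f i (x i))) (Pi\<^sub>E I A) =
      (\<Prod>i\<in>I. emeasure (density N (f i)) (A i))" .
  qed (use \<open>finite I\<close> in \<open>auto intro!: sets_PiM_cong\<close>)
qed

text \<open>Independence gives the coordinates a joint law with product density. Reassembling the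
  vector through \<open>?T\<close> carries Lebesgue measure on the coordinates to Lebesgue measure
  on the space, and the product density to \<open>gauss_density v\<close>.\<close>

lemma (in prob_space) distr_eq_gauss:
  fixes X :: "'a \<Rightarrow> 'b::euclidean_space"
  assumes v: "v > 0"
    and X: "\<And>b. b \<in> Basis \<Longrightarrow> distributed M lborel (\<lambda>\<omega>. X \<omega> \<bullet> b) (normal_density 0 (sqrt v))"
    and indep: "indep_vars (\<lambda>_. borel) (\<lambda>b \<omega>. X \<omega> \<bullet> b) Basis"
  shows "distr M borel X = gauss v"
proof -
  let ?n = "\<lambda>x. ennreal (normal_density 0 (sqrt v) x)"
  let ?T = "\<lambda>f. \<Sum>b\<in>(Basis::'b set). f b *\<^sub>R b"
  have Xb [measurable]: "(\<lambda>\<omega>. X \<omega> \<bullet> b) \<in> borel_measurable M" if "b \<in> Basis" for b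
    using distributed_measurable[OF X[OF that]] by simp
  have law: "distr M borel (\<lambda>\<omega>. X \<omega> \<bullet> b) = density lborel ?n" if "b \<in> Basis" for b
    using distributed_distr_eq_density[OF X[OF that]] by (simp cong: distr_cong)
  have T [measurable]: "?T \<in> borel_measurable (PiM Basis (\<lambda>_. borel))"
    by measurable
  have T' [measurable]: "?T \<in> borel_measurable (PiM Basis (\<lambda>_. lborel))"
    by measurable
  have sf: "sigma_finite_measure (density lborel ?n)"
    using prob_space_normal_density[of "sqrt v" 0] v
    by (intro prob_space_imp_sigma_finite) auto
  have joint: "distr M (PiM Basis (\<lambda>_. borel)) (\<lambda>\<omega>. \<lambda>b\<in>Basis. X \<omega> \<bullet> b) =
      density (PiM Basis (\<lambda>_. lborel)) (\<lambda>f. \<Prod>b\<in>(Basis::'b set). ?n (f b))"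
  proof -
    have "distr M (PiM Basis (\<lambda>_. borel)) (\<lambda>\<omega>. \<lambda>b\<in>Basis. X \<omega> \<bullet> b) =
      PiM Basis (\<lambda>b. distr M borel (\<lambda>\<omega>. X \<omega> \<bullet> b))"
      using indep by (subst (asm) indep_vars_iff_distr_eq_PiM') auto
    also have "\<dots> = PiM Basis (\<lambda>_::'b. density lborel ?n)"
      by (intro PiM_cong refl law)
    also have "\<dots> = density (PiM Basis (\<lambda>_. lborel)) (\<lambda>f. \<Prod>b\<in>(Basis::'b set). ?n (f b))"
      by (intro PiM_density_prod sf lborel.sigma_finite_measure_axioms) auto
    finally show ?thesis .
  qed
  have meas: "(\<lambda>\<omega>. \<lambda>b\<in>Basis. X \<omega> \<bullet> b) \<in> measurable M (PiM Basis (\<lambda>_. borel))"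
    by measurable
  have "distr M borel X = distr M borel (?T \<circ> (\<lambda>\<omega>. \<lambda>b\<in>Basis. X \<omega> \<bullet> b))"
    by (intro distr_cong) (auto simp: euclidean_representation)
  also have "\<dots> = distr (density (PiM Basis (\<lambda>_. lborel)) (\<lambda>f. \<Prod>b\<in>(Basis::'b set). ?n (f b))) borel ?T"
    by (subst distr_distr[symmetric, OF T meas]) (simp add: joint)
  also have "\<dots> = density (distr (PiM Basis (\<lambda>_. lborel)) borel ?T) (\<lambda>x. ennreal (gauss_density v x))"
  proof (rule measure_eqI)
    fix A assume "A \<in> sets (distr (density (PiM Basis (\<lambda>_. lborel)) (\<lambda>f. \<Prod>b\<in>(Basis::'b set). ?n (f b))) borel ?T)"
    then have [measurable]: "A \<in> sets borel" by simp
    have [measurable]: "(\<lambda>f. \<Prod>b\<in>(Basis::'b set). ?n (f b)) \<in> borel_measurable (PiM Basis (\<lambda>_. lborel))"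
      by measurable
    have "ennreal (gauss_density v (?T f)) = (\<Prod>b\<in>(Basis::'b set). ?n (f b))" for f
      by (simp add: gauss_density_prod v prod_ennreal)
    then show "emeasure (distr (density (PiM Basis (\<lambda>_. lborel)) (\<lambda>f. \<Prod>b\<in>(Basis::'b set). ?n (f b))) borel ?T) A
       = emeasure (density (distr (PiM Basis (\<lambda>_. lborel)) borel ?T) (\<lambda>x. ennreal (gauss_density v x))) A"
      by (simp add: emeasure_distr emeasure_density nn_integral_distr measurable_sets)
         (auto intro!: nn_integral_cong simp: indicator_def)
  qed simp
  also have "\<dots> = gauss v"
    by (simp add: gauss_def lborel_eq[symmetric])
  finally show ?thesis .
qed

section \<open>Convolution, scaling and integrability of Gaussian measures\<close>

lemma nn_integral_lborel_shift:
  fixes c :: "'a::euclidean_space"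
  assumes [measurable]: "f \<in> borel_measurable borel"
  shows "(\<integral>\<^sup>+x. f (x + c) \<partial>lborel) = (\<integral>\<^sup>+x. f x \<partial>lborel)"
proof -
  have "(\<integral>\<^sup>+x. f x \<partial>lborel) = (\<integral>\<^sup>+x. f x \<partial>distr lborel borel ((+) c))"
    by (simp add: lborel_distr_plus)
  then show ?thesis
    by (simp add: nn_integral_distr add.commute)
qed

lemma nn_integral_gauss:
  assumes [measurable]: "f \<in> borel_measurable borel"
  shows "(\<integral>\<^sup>+x. f x \<partial>gauss v) = (\<integral>\<^sup>+x. ennreal (gauss_density v x) * f x \<partial>lborel)"
  unfolding gauss_def by (rule nn_integral_density) auto

lemma nn_integral_gauss_density: "v > 0 \<Longrightarrow> (\<integral>\<^sup>+x. ennreal (gauss_density v (x::'a::euclidean_space)) \<partial>lborel) = 1"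
  using prob_space.emeasure_space_1[OF prob_space_gauss[of v, where 'a='a]]
  by (simp add: gauss_def emeasure_density)

text \<open>Completing the square in \<open>y\<close>. If \<open>x\<close> is the sum of
  \<open>y\<close> and an independent Gaussian of variance \<open>s\<close>, the right-hand side is
  the density of \<open>x\<close> times the conditional density of \<open>y\<close> given
  \<open>x\<close>, which has mean \<open>(t / (s + t)) *\<^sub>R x\<close> and variance
  \<open>s * t / (s + t)\<close>.\<close>

lemma gauss_density_mult:
  fixes x y :: "'a::euclidean_space"
  assumes s: "s > 0" and t: "t > 0"
  shows "gauss_density s (x - y) * gauss_density t y =
    gauss_density (s + t) x * gauss_density (s * t / (s + t)) (y - (t / (s + t)) *\<^sub>R x)"
proof -
  have n: "(norm (a - b))\<^sup>2 = (norm a)\<^sup>2 - 2 * (a \<bullet> b) + (norm b)\<^sup>2" for a b :: 'a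
    by (simp add: power2_norm_eq_inner inner_simps inner_commute)
  have "(norm (x - y))\<^sup>2 / (2 * s) + (norm y)\<^sup>2 / (2 * t) =
     (norm x)\<^sup>2 / (2 * (s + t)) + (norm (y - (t / (s + t)) *\<^sub>R x))\<^sup>2 / (2 * (s * t / (s + t)))"
  proof -
    \<comment> \<open>Only these three inner products enter, so the vector identity becomes an
      identity of rational functions.\<close>
    define a b c where "a = (norm x)\<^sup>2" and "b = (norm y)\<^sup>2" and "c = x \<bullet> y"
    have "(norm (y - (t / (s + t)) *\<^sub>R x))\<^sup>2 = b - 2 * (t / (s + t)) * c + (t / (s + t))\<^sup>2 * a"
      unfolding n a_def b_def c_def by (simp add: power_mult_distrib inner_commute power_divide)
    moreover have "(norm (x - y))\<^sup>2 = a - 2 * c + b"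
      unfolding n a_def b_def c_def ..
    moreover have "s + t \<noteq> 0" using assms by simp
    moreover have "(a - 2 * c + b) / (2 * s) + b / (2 * t) = a / (2 * (s + t)) +
        (b - 2 * (t / (s + t)) * c + (t / (s + t))\<^sup>2 * a) / (2 * (s * t / (s + t)))"
    proof -
      have "(b - 2 * (t / (s + t)) * c + (t / (s + t))\<^sup>2 * a) / (2 * (s * t / (s + t)))
         = (b * (s + t) - 2 * t * c + t\<^sup>2 * a / (s + t)) / (2 * s * t)"
      proof -
        have "u * (b - 2 * (t / u) * c + (t / u)\<^sup>2 * a) = b * u - 2 * t * c + t\<^sup>2 * a / u"
          if "u \<noteq> 0" for u :: real
          using that by (simp add: power2_eq_square algebra_simps)
        from this[OF \<open>s + t \<noteq> 0\<close>] show ?thesis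
          by (simp add: mult.commute mult.left_commute)
      qed
      moreover have "a / (2 * (s + t)) = (s * t * a / (s + t)) / (2 * s * t)"
        using s t by simp
      moreover have "x / d + (y - z + w) / d = (y - z + (x + w)) / d" for x y z w d :: real
        by (simp add: add_divide_distrib diff_divide_distrib)
      moreover have "s * t * a / (s + t) + t\<^sup>2 * a / (s + t) = t * a"
      proof -
        have "s * t * a + t\<^sup>2 * a = t * a * (s + t)"
          by (simp add: power2_eq_square algebra_simps)
        then show ?thesis
          using \<open>s + t \<noteq> 0\<close> unfolding add_divide_distrib[symmetric] by simp
      qed
      ultimately have "a / (2 * (s + t)) +
        (b - 2 * (t / (s + t)) * c + (t / (s + t))\<^sup>2 * a) / (2 * (s * t / (s + t)))
        = (b * (s + t) - 2 * t * c + t * a) / (2 * s * t)"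
        by presburger
      then show ?thesis
        using s t by (simp add: field_simps)
    qed
    ultimately show ?thesis
      unfolding a_def[symmetric] b_def[symmetric] by simp
  qed
  then have e: "exp (- (norm (x - y))\<^sup>2 / (2 * s)) * exp (- (norm y)\<^sup>2 / (2 * t)) =
     exp (- (norm x)\<^sup>2 / (2 * (s + t))) * exp (- (norm (y - (t / (s + t)) *\<^sub>R x))\<^sup>2 / (2 * (s * t / (s + t))))"
    unfolding exp_add[symmetric] by simp
  have "sqrt (2 * pi * s) * sqrt (2 * pi * t) = sqrt (2 * pi * (s + t)) * sqrt (2 * pi * (s * t / (s + t)))"
    unfolding real_sqrt_mult[symmetric] using assms by (simp add: field_simps)
  then have c: "sqrt (2 * pi * s) ^ DIM('a) * sqrt (2 * pi * t) ^ DIM('a) =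
    sqrt (2 * pi * (s + t)) ^ DIM('a) * sqrt (2 * pi * (s * t / (s + t))) ^ DIM('a)"
    unfolding power_mult_distrib[symmetric] by simp
  show ?thesis
    unfolding gauss_density_def times_divide_times_eq e c ..
qed

text \<open>Gaussian measures form a convolution semigroup. After translating \<open>x\<close> and
  exchanging the integrals, \<open>gauss_density_mult\<close> leaves a conditional density in
  \<open>y\<close>, whose integral is 1.\<close>

lemma nn_integral_gauss_add:
  fixes f :: "'a::euclidean_space \<Rightarrow> ennreal"
  assumes s: "s > 0" and t: "t > 0" and [measurable]: "f \<in> borel_measurable borel"
  shows "(\<integral>\<^sup>+x. f x \<partial>gauss (s + t)) = (\<integral>\<^sup>+y. (\<integral>\<^sup>+x. f (x + y) \<partial>gauss s) \<partial>gauss t)"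
proof -
  let ?g = "\<lambda>v x. ennreal (gauss_density v (x::'a))"
  have "(\<integral>\<^sup>+y. (\<integral>\<^sup>+x. f (x + y) \<partial>gauss s) \<partial>gauss t) =
      (\<integral>\<^sup>+y. ?g t y * (\<integral>\<^sup>+x. ?g s x * f (x + y) \<partial>lborel) \<partial>lborel)"
    by (simp add: nn_integral_gauss)
  also have "\<dots> = (\<integral>\<^sup>+y. ?g t y * (\<integral>\<^sup>+x. ?g s (x - y) * f x \<partial>lborel) \<partial>lborel)"
    using nn_integral_lborel_shift[of "\<lambda>x. ?g s (x - y) * f x" y for y]
    by simp
  also have "\<dots> = (\<integral>\<^sup>+y. (\<integral>\<^sup>+x. ?g t y * (?g s (x - y) * f x) \<partial>lborel) \<partial>lborel)"
    by (intro nn_integral_cong nn_integral_cmult[symmetric]) simp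
  also have "\<dots> = (\<integral>\<^sup>+x. (\<integral>\<^sup>+y. ?g t y * (?g s (x - y) * f x) \<partial>lborel) \<partial>lborel)"
    by (intro lborel_pair.Fubini') simp
  also have "\<dots> = (\<integral>\<^sup>+x. (\<integral>\<^sup>+y. ?g (s + t) x * f x * ?g (s * t / (s + t)) (y - (t / (s + t)) *\<^sub>R x) \<partial>lborel) \<partial>lborel)"
  proof (intro nn_integral_cong)
    fix x y :: 'a
    have "?g t y * ?g s (x - y) = ?g (s + t) x * ?g (s * t / (s + t)) (y - (t / (s + t)) *\<^sub>R x)"
      using s t gauss_density_mult[OF s t, of x y]
      by (simp add: ennreal_mult[symmetric] mult.commute)
    then show "?g t y * (?g s (x - y) * f x) =
       ?g (s + t) x * f x * ?g (s * t / (s + t)) (y - (t / (s + t)) *\<^sub>R x)"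
      by (metis mult.assoc mult.commute)
  qed
  also have "\<dots> = (\<integral>\<^sup>+x. ?g (s + t) x * f x \<partial>lborel)"
  proof (intro nn_integral_cong)
    fix x :: 'a
    have "(\<integral>\<^sup>+y. ?g (s * t / (s + t)) (y - (t / (s + t)) *\<^sub>R x) \<partial>lborel) = 1"
      using nn_integral_lborel_shift[of "?g (s * t / (s + t))" "- (t / (s + t)) *\<^sub>R x"] s t
      by (simp add: nn_integral_gauss_density)
    then show "(\<integral>\<^sup>+y. ?g (s + t) x * f x * ?g (s * t / (s + t)) (y - (t / (s + t)) *\<^sub>R x) \<partial>lborel) = ?g (s + t) x * f x"
      by (subst nn_integral_cmult) simp_all
  qed
  finally show ?thesis
    by (simp add: nn_integral_gauss)
qed

text \<open>Recasts the semigroup property as the law of a sum of independent vectors, so that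
  Fubini handles signed integrands in \<open>integral_gauss_add\<close>.\<close>

lemma distr_pair_gauss_add:
  assumes s: "s > 0" and t: "t > 0"
  shows "distr (gauss t \<Otimes>\<^sub>M gauss s) borel (\<lambda>(y, x). x + y) = (gauss (s + t) :: 'a::euclidean_space measure)"
proof (rule measure_eqI)
  interpret S: prob_space "gauss s :: 'a measure" by (rule prob_space_gauss[OF s])
  fix A assume "A \<in> sets (distr (gauss t \<Otimes>\<^sub>M gauss s) borel (\<lambda>(y, x). x + (y::'a)))"
  then have [measurable]: "A \<in> sets borel" by simp
  have "emeasure (distr (gauss t \<Otimes>\<^sub>M gauss s) borel (\<lambda>(y, x). x + y)) A =
     (\<integral>\<^sup>+p. indicator A p \<partial>distr (gauss t \<Otimes>\<^sub>M gauss s) borel (\<lambda>(y, x). x + y))"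
    by simp
  also have "\<dots> = (\<integral>\<^sup>+p. indicator A (snd p + fst p) \<partial>(gauss t \<Otimes>\<^sub>M gauss s))"
    by (subst nn_integral_distr) (auto simp: case_prod_beta)
  also have "\<dots> = (\<integral>\<^sup>+y. (\<integral>\<^sup>+x. indicator A (x + y) \<partial>gauss s) \<partial>gauss t)"
    by (subst S.nn_integral_fst[symmetric]) auto
  also have "\<dots> = emeasure (gauss (s + t)) A"
    using nn_integral_gauss_add[OF s t, of "indicator A"] by simp
  finally show "emeasure (distr (gauss t \<Otimes>\<^sub>M gauss s) borel (\<lambda>(y, x). x + y)) A = emeasure (gauss (s + t)) A" .
qed simp

text \<open>The Jacobian \<open>s ^ DIM('a)\<close> of the dilation cancels against the change of
  the normalizing constant.\<close>

lemma gauss_scale: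
  assumes s: "s > 0" and v: "v > 0"
  shows "distr (gauss v) borel (\<lambda>x. s *\<^sub>R x) = (gauss (s\<^sup>2 * v) :: 'a::euclidean_space measure)"
proof (rule measure_eqI)
  fix A assume "A \<in> sets (distr (gauss v) borel (\<lambda>x. s *\<^sub>R (x::'a)))"
  then have [measurable]: "A \<in> sets borel" by simp
  let ?d = "DIM('a)"
  have d: "gauss_density v x = s ^ ?d * gauss_density (s\<^sup>2 * v) (s *\<^sub>R x)" for x :: 'a
  proof -
    have "sqrt (2 * pi * (s\<^sup>2 * v)) = s * sqrt (2 * pi * v)"
      using s by (simp add: real_sqrt_mult)
    then show ?thesis
      using s v by (simp add: gauss_density_def power_mult_distrib field_simps)
  qed
  have "emeasure (gauss (s\<^sup>2 * v)) A = (\<integral>\<^sup>+x. ennreal (gauss_density (s\<^sup>2 * v) x) * indicator A x \<partial>lborel)"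
    by (simp add: gauss_def emeasure_density)
  also have "\<dots> = (\<integral>\<^sup>+x. ennreal (s ^ ?d) * (ennreal (gauss_density (s\<^sup>2 * v) (s *\<^sub>R x)) * indicator A (s *\<^sub>R x)) \<partial>lborel)"
    using s by (subst lborel_affine[of s 0]) (simp_all add: nn_integral_density nn_integral_distr)
  also have "\<dots> = (\<integral>\<^sup>+x. ennreal (gauss_density v x) * indicator A (s *\<^sub>R x) \<partial>lborel)"
    using s v by (intro nn_integral_cong) (simp add: d[symmetric] ennreal_mult[symmetric] mult.assoc[symmetric])
  also have "\<dots> = (\<integral>\<^sup>+x. indicator A (s *\<^sub>R x) \<partial>gauss v)"
    by (simp add: nn_integral_gauss)
  also have "\<dots> = emeasure (distr (gauss v) borel (\<lambda>x. s *\<^sub>R x)) A"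
    by (simp add: nn_integral_distr flip: nn_integral_indicator)
  finally show "emeasure (distr (gauss v) borel (\<lambda>x. s *\<^sub>R x)) A = emeasure (gauss (s\<^sup>2 * v)) A" ..
qed simp

text \<open>Doubling the variance absorbs the factor, because
  \<open>c * norm x \<le> (norm x)\<^sup>2 / (4 * v) + v * c\<^sup>2\<close>. The constant
  \<open>C\<close> collects \<open>exp (v * c\<^sup>2)\<close> and the ratio of the two normalizing
  constants.\<close>

lemma integrable_gauss_exp_norm:
  assumes v: "v > 0"
  shows "integrable (gauss v :: 'a::euclidean_space measure) (\<lambda>x. exp (c * norm x))"
proof (rule integrableI_bounded)
  define C where "C = exp (v * c\<^sup>2) * sqrt 2 ^ DIM('a)"
  have b: "gauss_density v x * exp (c * norm x) \<le> C * gauss_density (2 * v) x" for x :: 'a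
  proof -
    have "0 \<le> (norm x - 2 * v * c)\<^sup>2" by simp
    also have "\<dots> = (norm x)\<^sup>2 - 4 * v * (c * norm x) + 4 * v * (v * c\<^sup>2)"
      by (simp add: power2_eq_square algebra_simps)
    finally have "0 \<le> ((norm x)\<^sup>2 - 4 * v * (c * norm x) + 4 * v * (v * c\<^sup>2)) / (4 * v)"
      using v by simp
    also have "\<dots> = (norm x)\<^sup>2 / (4 * v) - c * norm x + v * c\<^sup>2"
      using v by (simp add: add_divide_distrib diff_divide_distrib)
    finally have "- (norm x)\<^sup>2 / (2 * v) + c * norm x \<le> v * c\<^sup>2 + - (norm x)\<^sup>2 / (4 * v)"
      using v by simp
    then have "exp (- (norm x)\<^sup>2 / (2 * v)) * exp (c * norm x) \<le> exp (v * c\<^sup>2) * exp (- (norm x)\<^sup>2 / (4 * v))"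
      unfolding exp_add[symmetric] by simp
    moreover have "sqrt (2 * pi * (2 * v)) ^ DIM('a) = sqrt 2 ^ DIM('a) * sqrt (2 * pi * v) ^ DIM('a)"
      unfolding power_mult_distrib[symmetric] real_sqrt_mult[symmetric] by (simp add: ac_simps)
    ultimately show ?thesis
      using v by (simp add: gauss_density_def C_def divide_right_mono)
  qed
  have "(\<integral>\<^sup>+x. ennreal (norm (exp (c * norm x))) \<partial>(gauss v :: 'a measure)) \<le>
      (\<integral>\<^sup>+x. ennreal C * ennreal (gauss_density (2 * v) (x::'a)) \<partial>lborel)"
    using v b by (subst nn_integral_gauss)
      (auto intro!: nn_integral_mono simp: ennreal_mult[symmetric] C_def ennreal_leI)
  also have "\<dots> = ennreal C"
    using v by (subst nn_integral_cmult) (simp_all add: nn_integral_gauss_density)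
  finally show "(\<integral>\<^sup>+x. ennreal (norm (exp (c * norm x))) \<partial>(gauss v :: 'a measure)) < \<infinity>"
    by (simp add: order_le_less_trans)
qed simp

lemma integrable_gauss_bound:
  fixes f :: "'a::euclidean_space \<Rightarrow> real"
  assumes v: "v > 0" and [measurable]: "f \<in> borel_measurable borel"
    and b: "\<And>x. \<bar>f x\<bar> \<le> a * exp (c * norm x)"
  shows "integrable (gauss v) f"
proof (rule Bochner_Integration.integrable_bound)
  show "integrable (gauss v) (\<lambda>x::'a. a * exp (c * norm x))"
    by (intro integrable_mult_right integrable_gauss_exp_norm v)
  show "AE x in gauss v. norm (f x) \<le> norm (a * exp (c * norm x))"
    using b by (auto intro: order_trans[OF _ abs_ge_self])
qed simp

lemma integral_gauss_add:
  fixes f :: "'a::euclidean_space \<Rightarrow> real"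
  assumes s: "s > 0" and t: "t > 0" and f: "integrable (gauss (s + t)) f"
  shows "(\<integral>y. (\<integral>x. f (x + y) \<partial>gauss s) \<partial>gauss t) = (\<integral>x. f x \<partial>gauss (s + t))"
proof -
  interpret S: prob_space "gauss s :: 'a measure" by (rule prob_space_gauss[OF s])
  interpret T: prob_space "gauss t :: 'a measure" by (rule prob_space_gauss[OF t])
  interpret P: pair_sigma_finite "gauss t :: 'a measure" "gauss s :: 'a measure" ..
  have [measurable]: "f \<in> borel_measurable borel"
    using borel_measurable_integrable[OF f] by simp
  have "integrable (distr (gauss t \<Otimes>\<^sub>M gauss s) borel (\<lambda>(y, x). x + y)) f"
    using f by (simp add: distr_pair_gauss_add[OF s t])
  then have i: "integrable (gauss t \<Otimes>\<^sub>M gauss s) (\<lambda>(y, x). f (x + y))"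
    by (subst (asm) integrable_distr_eq) (auto simp: case_prod_beta')
  have "(\<integral>x. f x \<partial>gauss (s + t)) = (\<integral>x. f x \<partial>distr (gauss t \<Otimes>\<^sub>M gauss s) borel (\<lambda>(y, x). x + y))"
    by (simp add: distr_pair_gauss_add[OF s t])
  also have "\<dots> = (\<integral>(y, x). f (x + y) \<partial>(gauss t \<Otimes>\<^sub>M gauss s))"
    by (subst integral_distr) (auto simp: case_prod_beta')
  also have "\<dots> = (\<integral>y. (\<integral>x. f (x + y) \<partial>gauss s) \<partial>gauss t)"
    by (rule P.integral_fst'[OF i, symmetric, simplified])
  finally show ?thesis ..
qed

section \<open>Convex Lipschitz functions under Gaussian averaging\<close>

text \<open>The two properties are bundled because both survive, with the same constant, Gaussian
  averaging and the passage to the Moreau envelope.\<close>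

definition lipschitz_convex :: "real \<Rightarrow> ('a::euclidean_space \<Rightarrow> real) \<Rightarrow> bool" where
  "lipschitz_convex L f \<longleftrightarrow> convex_on UNIV f \<and> (\<forall>x y. \<bar>f x - f y\<bar> \<le> L * norm (x - y))"

lemma lipschitz_convexD:
  assumes "lipschitz_convex L f"
  shows "convex_on UNIV f" "\<bar>f x - f y\<bar> \<le> L * norm (x - y)"
  using assms by (auto simp: lipschitz_convex_def)

lemma lipschitz_convex_measurable:
  fixes f :: "'a::euclidean_space \<Rightarrow> real"
  assumes "lipschitz_convex L f"
  shows "f \<in> borel_measurable borel"
proof -
  have "\<bar>L\<bar>-lipschitz_on UNIV f"
  proof (rule lipschitz_onI)
    show "dist (f x) (f y) \<le> \<bar>L\<bar> * dist x y" for x y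
      using lipschitz_convexD(2)[OF assms, of x y] mult_right_mono[OF abs_ge_self[of L], of "norm (x - y)"]
      by (simp add: dist_norm)
  qed simp
  then show ?thesis
    by (intro borel_measurable_continuous_onI lipschitz_on_continuous_on)
qed

text \<open>Separate the origin from \<open>S\<close>, the strict epigraph of \<open>f\<close> moved
  so that the point of the graph above \<open>x\<close> becomes the origin. The separating vector
  \<open>(p, c)\<close> has \<open>c > 0\<close>, since \<open>c = 0\<close> would force
  \<open>p = 0\<close>; then \<open>- (1 / c) *\<^sub>R p\<close> is a subgradient.\<close>

lemma subgradient_exists:
  fixes f :: "'a::euclidean_space \<Rightarrow> real"
  assumes "convex_on UNIV f"
  obtains v where "\<And>h. f x + v \<bullet> h \<le> f (x + h)"
proof -
  define S where "S = {(h, t). f (x + h) - f x < t}"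
  have "convex S"
  proof (rule convexI)
    fix p q and u w :: real
    assume p: "p \<in> S" and q: "q \<in> S" and u: "0 \<le> u" "0 \<le> w" "u + w = 1"
    obtain h t where ht: "p = (h, t)" by (cases p)
    obtain h' t' where ht': "q = (h', t')" by (cases q)
    have e: "x + (u *\<^sub>R h + w *\<^sub>R h') = u *\<^sub>R (x + h) + w *\<^sub>R (x + h')"
    proof -
      have "u *\<^sub>R x + w *\<^sub>R x = x"
        using u(3) by (metis scaleR_left_distrib scaleR_one)
      then show ?thesis by (simp add: scaleR_add_right ac_simps)
    qed
    have "f (x + (u *\<^sub>R h + w *\<^sub>R h')) \<le> u * f (x + h) + w * f (x + h')"
      unfolding e using assms u by (simp add: convex_on_def)
    moreover have "u * f x + w * f x = f x"
      using u(3) by (metis distrib_right mult_1)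
    \<comment> \<open>Strictness comes from the first summand, unless \<open>u = 0\<close>; then
      \<open>w = 1\<close> and the second summand supplies it.\<close>
    moreover have "u * (f (x + h) - f x) + w * (f (x + h') - f x) < u * t + w * t'"
    proof (cases "u = 0")
      case True
      then show ?thesis using q u ht' by (simp add: S_def)
    next
      case False
      have "u * (f (x + h) - f x) < u * t"
        using False p u ht by (simp add: S_def)
      moreover have "w * (f (x + h') - f x) \<le> w * t'"
        using q u ht' by (intro mult_left_mono) (simp_all add: S_def)
      ultimately show ?thesis by simp
    qed
    ultimately have "f (x + (u *\<^sub>R h + w *\<^sub>R h')) - f x < u * t + w * t'"
      by (simp add: algebra_simps)
    then show "u *\<^sub>R p + w *\<^sub>R q \<in> S"
      by (simp add: S_def ht ht')
  qed
  have "0 \<notin> S"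
    by (simp add: S_def zero_prod_def)
  from separating_hyperplane_set_0[OF \<open>convex S\<close> this]
  obtain a where a: "a \<noteq> 0" "\<And>y. y \<in> S \<Longrightarrow> 0 \<le> a \<bullet> y"
    by blast
  obtain p c where pc: "a = (p, c)" by (cases a)
  have pos: "0 \<le> p \<bullet> h + c * t" if "f (x + h) - f x < t" for h t
    using a(2)[of "(h, t)"] that by (simp add: S_def pc)
  \<comment> \<open>The limit of \<open>pos\<close> as \<open>t\<close> decreases to the increment
    of \<open>f\<close>. The slack \<open>e / (\<bar>c\<bar> + 1)\<close> has a multiple by
    \<open>c\<close> of at most \<open>e\<close>, whatever the sign of \<open>c\<close>.\<close>
  have le: "0 \<le> p \<bullet> h + c * (f (x + h) - f x)" for h
  proof (rule field_le_epsilon)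
    fix e :: real assume "e > 0"
    have "0 \<le> p \<bullet> h + c * (f (x + h) - f x + e / (\<bar>c\<bar> + 1))"
      by (rule pos) (use \<open>e > 0\<close> in \<open>simp add: add_nonneg_pos\<close>)
    moreover have "c * (e / (\<bar>c\<bar> + 1)) \<le> e"
    proof -
      have "c * e \<le> (\<bar>c\<bar> + 1) * e"
        using \<open>e > 0\<close> by (intro mult_right_mono) auto
      then show ?thesis by (simp add: divide_simps mult.commute)
    qed
    ultimately show "0 \<le> p \<bullet> h + c * (f (x + h) - f x) + e"
      by (simp add: distrib_left)
  qed
  have "c > 0"
  proof -
    have "c \<ge> 0"
      using pos[of 0 1] by simp
    moreover have "c \<noteq> 0"
    proof
      assume "c = 0"
      with le[of "- p"] inner_ge_zero[of p] have "p \<bullet> p = 0" by simp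
      then have "p = 0" by simp
      with \<open>c = 0\<close> a(1) pc show False by (simp add: zero_prod_def)
    qed
    ultimately show ?thesis by simp
  qed
  show ?thesis
  proof
    fix h
    have "0 \<le> (p \<bullet> h + c * (f (x + h) - f x)) / c"
      using le[of h] \<open>c > 0\<close> by simp
    then show "f x + (- (1 / c) *\<^sub>R p) \<bullet> h \<le> f (x + h)"
      using \<open>c > 0\<close> by (simp add: add_divide_distrib)
  qed
qed

section \<open>Growth bounds and Gaussian moments\<close>

lemma power_le_fact_mult_exp:
  fixes x :: real
  assumes "0 \<le> x"
  shows "x ^ k \<le> fact k * exp x"
proof -
  have "(\<Sum>n\<in>{k}. x ^ n /\<^sub>R fact n) \<le> (\<Sum>n. x ^ n /\<^sub>R fact n)"
    using assms by (intro sum_le_suminf summable_exp_generic) auto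
  then have "x ^ k / fact k \<le> exp x"
    by (simp add: exp_def divide_inverse mult.commute)
  then show ?thesis
    by (simp add: divide_simps mult.commute)
qed

lemma integrable_gauss_norm_power:
  assumes "v > 0"
  shows "integrable (gauss v :: 'a::euclidean_space measure) (\<lambda>x. norm x ^ k)"
  by (rule integrable_gauss_bound[OF assms, where a = "fact k" and c = 1])
     (simp_all add: power_le_fact_mult_exp)

text \<open>A Lipschitz function grows at most linearly, so it and its exponentials are dominated by
  multiples of \<open>exp (c * norm y)\<close>.\<close>

lemma integrable_lipschitz_gauss:
  fixes f :: "'a::euclidean_space \<Rightarrow> real" and x :: 'a
  assumes v: "v > 0" and L: "L \<ge> 0" and f: "lipschitz_convex L f"
  shows "integrable (gauss v) (\<lambda>y. f (x + y))"
    and "integrable (gauss v) (\<lambda>y. exp (l * f (x + y)))"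
proof -
  note [measurable] = lipschitz_convex_measurable[OF f]
  have b: "\<bar>f (x + y)\<bar> \<le> \<bar>f x\<bar> + L * norm y" for y
    using lipschitz_convexD(2)[OF f, of "x + y" x] by simp
  show "integrable (gauss v) (\<lambda>y. f (x + y))"
  proof (rule integrable_gauss_bound[OF v])
    fix y :: 'a
    have "\<bar>f x\<bar> + L * norm y \<le> (\<bar>f x\<bar> + L) * (1 + norm y)"
      using L by (simp add: algebra_simps)
    also have "\<dots> \<le> (\<bar>f x\<bar> + L) * exp (norm y)"
      using L by (intro mult_left_mono exp_ge_add_one_self) auto
    finally show "\<bar>f (x + y)\<bar> \<le> (\<bar>f x\<bar> + L) * exp (1 * norm y)"
      using b[of y] by simp
  qed measurable
  show "integrable (gauss v) (\<lambda>y. exp (l * f (x + y)))"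
  proof (rule integrable_gauss_bound[OF v])
    fix y :: 'a
    have "l * f (x + y) \<le> \<bar>l\<bar> * \<bar>f (x + y)\<bar>"
      by (metis abs_ge_self abs_mult)
    also have "\<dots> \<le> \<bar>l\<bar> * (\<bar>f x\<bar> + L * norm y)"
      by (intro mult_left_mono b) auto
    finally show "\<bar>exp (l * f (x + y))\<bar> \<le> exp (\<bar>l\<bar> * \<bar>f x\<bar>) * exp ((\<bar>l\<bar> * L) * norm y)"
      by (simp add: distrib_left mult.assoc flip: exp_add)
  qed measurable
qed

text \<open>Completing the square: the factor \<open>exp (w \<bullet> x)\<close> translates the
  Gaussian by \<open>v *\<^sub>R w\<close> and multiplies it by the stated constant.\<close>

lemma integral_gauss_exp_inner:
  fixes w :: "'a::euclidean_space"
  assumes v: "v > 0"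
  shows "(\<integral>x. exp (w \<bullet> x) \<partial>gauss v) = exp (v * (norm w)\<^sup>2 / 2)"
proof -
  have d: "gauss_density v x * exp (w \<bullet> x) = exp (v * (norm w)\<^sup>2 / 2) * gauss_density v (x + (- v) *\<^sub>R w)" for x
  proof -
    have "(norm (x + (- v) *\<^sub>R w))\<^sup>2 = (norm x)\<^sup>2 - 2 * v * (w \<bullet> x) + v\<^sup>2 * (norm w)\<^sup>2"
      unfolding power2_norm_eq_inner by (simp add: inner_simps inner_commute power2_eq_square)
    then have "- (norm x)\<^sup>2 / (2 * v) + w \<bullet> x = v * (norm w)\<^sup>2 / 2 + - (norm (x + (- v) *\<^sub>R w))\<^sup>2 / (2 * v)"
      using v by (simp add: power2_eq_square field_simps)
    then have "exp (- (norm x)\<^sup>2 / (2 * v)) * exp (w \<bullet> x) = exp (v * (norm w)\<^sup>2 / 2) * exp (- (norm (x + (- v) *\<^sub>R w))\<^sup>2 / (2 * v))"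
      unfolding exp_add[symmetric] by simp
    then show ?thesis
      unfolding gauss_density_def by simp
  qed
  have "(\<integral>\<^sup>+x. ennreal (exp (w \<bullet> x)) \<partial>gauss v) =
      (\<integral>\<^sup>+x. ennreal (exp (v * (norm w)\<^sup>2 / 2)) * ennreal (gauss_density v (x + (- v) *\<^sub>R w)) \<partial>lborel)"
    using v by (subst nn_integral_gauss) (auto simp: ennreal_mult[symmetric] d simp del: scaleR_minus_left)
  also have "\<dots> = ennreal (exp (v * (norm w)\<^sup>2 / 2))"
    using v nn_integral_lborel_shift[of "\<lambda>x. ennreal (gauss_density v x)" "(- v) *\<^sub>R w"]
    by (subst nn_integral_cmult) (simp_all add: nn_integral_gauss_density)
  finally show ?thesis
    by (subst integral_eq_nn_integral) auto
qed

lemma integral_gauss_inner_square: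
  fixes w :: "'a::euclidean_space"
  assumes v: "v > 0"
  shows "(\<integral>x. (w \<bullet> x)\<^sup>2 \<partial>gauss v) \<le> v * (norm w)\<^sup>2"
proof -
  define I where "I = (\<integral>x. (w \<bullet> x)\<^sup>2 \<partial>gauss v)"
  define a where "a = v * (norm w)\<^sup>2 / 2"
  interpret prob_space "gauss v :: 'a measure" by (rule prob_space_gauss[OF v])
  have int: "integrable (gauss v) (\<lambda>x. (w \<bullet> x)\<^sup>2)"
  proof (rule Bochner_Integration.integrable_bound)
    show "integrable (gauss v) (\<lambda>x. (norm w)\<^sup>2 * norm (x::'a) ^ 2)"
      by (intro integrable_mult_right integrable_gauss_norm_power v)
    show "AE x in gauss v. norm ((w \<bullet> x)\<^sup>2) \<le> norm ((norm w)\<^sup>2 * norm x ^ 2)"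
      using power_mono[OF Cauchy_Schwarz_ineq2 abs_ge_zero, of w _ 2] by (simp add: power_mult_distrib)
  qed simp
  have inte: "integrable (gauss v) (\<lambda>x. exp ((t *\<^sub>R w) \<bullet> x))" for t
  proof (rule integrable_gauss_bound[OF v])
    fix x :: 'a
    show "\<bar>exp ((t *\<^sub>R w) \<bullet> x)\<bar> \<le> 1 * exp (norm (t *\<^sub>R w) * norm x)"
      using Cauchy_Schwarz_ineq2[of "t *\<^sub>R w" x] by simp
  qed simp
  \<comment> \<open>Compare second-order terms in \<open>2 + t\<^sup>2 (w \<bullet> x)\<^sup>2 \<le> exp (t w \<bullet> x) + exp (- t w \<bullet> x)\<close> as \<open>t \<rightarrow> 0\<close>.\<close>
  have le: "t\<^sup>2 * I \<le> 2 * (exp (t\<^sup>2 * a) - 1)" for t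
  proof -
    \<comment> \<open>With \<open>u = \<bar>y\<bar> / 2\<close> the claim reads
      \<open>(2 * u)\<^sup>2 \<le> (exp u - exp (- u))\<^sup>2\<close>, the right side being
      \<open>exp y + exp (- y) - 2\<close>. The bound
      \<open>exp (- u) \<le> 1 - u + u\<^sup>2 / 2\<close> holds because the product of
      \<open>1 - u + u\<^sup>2 / 2\<close> and \<open>1 + u + u\<^sup>2 / 2\<close> is at least
      1.\<close>
    have c: "2 + y\<^sup>2 \<le> exp y + exp (- y)" for y :: real
    proof -
      have "(2 * u)\<^sup>2 \<le> (exp u - exp (- u))\<^sup>2" if "u \<ge> 0" for u :: real
      proof (rule power_mono)
        have "exp (- u) * (1 + u + u\<^sup>2 / 2) \<le> exp (- u) * exp u"
          using exp_lower_Taylor_quadratic[OF that] by (intro mult_left_mono) auto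
        also have "\<dots> = 1" by (simp flip: exp_add)
        also have "\<dots> \<le> 1 + (u\<^sup>2)\<^sup>2 / 4" by simp
        also have "\<dots> = (1 - u + u\<^sup>2 / 2) * (1 + u + u\<^sup>2 / 2)"
          by (simp add: power2_eq_square algebra_simps)
        finally have "exp (- u) \<le> 1 - u + u\<^sup>2 / 2"
          by (rule mult_right_le_imp_le) (use that in \<open>simp add: add_pos_nonneg\<close>)
        then show "2 * u \<le> exp u - exp (- u)"
          using exp_lower_Taylor_quadratic[OF that] by linarith
      qed (use that in simp)
      from this[of "\<bar>y\<bar> / 2"]
      have "y\<^sup>2 \<le> (exp (\<bar>y\<bar> / 2) - exp (- (\<bar>y\<bar> / 2)))\<^sup>2"
        by simp
      also have "\<dots> = exp \<bar>y\<bar> + exp (- \<bar>y\<bar>) - 2"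
      proof -
        have "(exp (\<bar>y\<bar> / 2))\<^sup>2 = exp \<bar>y\<bar>" "(exp (- (\<bar>y\<bar> / 2)))\<^sup>2 = exp (- \<bar>y\<bar>)"
          "exp (\<bar>y\<bar> / 2) * exp (- (\<bar>y\<bar> / 2)) = 1"
          by (simp_all add: power2_eq_square flip: exp_add)
        then show ?thesis
          by (simp add: power2_diff)
      qed
      finally show ?thesis
        by (simp add: abs_if split: if_splits)
    qed
    have "2 + t\<^sup>2 * I = (\<integral>x. 2 + t\<^sup>2 * (w \<bullet> x)\<^sup>2 \<partial>gauss v)"
      using int by (simp add: I_def prob_space[simplified])
    also have "\<dots> \<le> (\<integral>x. exp ((t *\<^sub>R w) \<bullet> x) + exp (((- t) *\<^sub>R w) \<bullet> x) \<partial>gauss v)"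
    proof (rule integral_mono)
      show "2 + t\<^sup>2 * (w \<bullet> x)\<^sup>2 \<le> exp ((t *\<^sub>R w) \<bullet> x) + exp (((- t) *\<^sub>R w) \<bullet> x)" for x
        using c[of "t * (w \<bullet> x)"] by (simp add: power_mult_distrib)
    qed (intro Bochner_Integration.integrable_add integrable_mult_right int inte integrable_const)+
    also have "\<dots> = 2 * exp (t\<^sup>2 * a)"
      using inte[of t] inte[of "- t"] v
      by (simp add: integral_gauss_exp_inner a_def power_mult_distrib algebra_simps del: inner_scaleR_left scaleR_minus_left)
    finally show ?thesis by simp
  qed
  \<comment> \<open>With \<open>u = t\<^sup>2\<close>, dividing \<open>le\<close> by
    \<open>u\<close> leaves a difference quotient of \<open>exp (u * a)\<close> at 0, whose limit is
    the derivative \<open>a\<close>; and \<open>2 * a\<close> is the claimed bound.\<close>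
  have "((\<lambda>u. (exp (u * a) - 1) / u) \<longlongrightarrow> a) (at_right 0)"
  proof -
    have "((\<lambda>u. exp (u * a)) has_real_derivative a) (at 0)"
      by (auto intro!: derivative_eq_intros)
    then have "((\<lambda>u. (exp (u * a) - 1) / u) \<longlongrightarrow> a) (at 0)"
      by (simp add: DERIV_def)
    then show ?thesis
      by (rule tendsto_within_subset) simp
  qed
  then have "((\<lambda>u. 2 * ((exp (u * a) - 1) / u)) \<longlongrightarrow> 2 * a) (at_right 0)"
    by (intro tendsto_intros)
  moreover have "\<forall>\<^sub>F u in at_right 0. I \<le> 2 * ((exp (u * a) - 1) / u)"
    using eventually_at_right_less[of "0::real"]
  proof eventually_elim
    case (elim u)
    with le[of "sqrt u"] show ?case by (simp add: field_simps)
  qed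
  ultimately have "I \<le> 2 * a"
    by (rule tendsto_lowerbound) simp
  then show ?thesis
    by (simp add: I_def a_def)
qed

text \<open>Stands for a Hessian of at most \<open>K\<close> without assuming derivatives; for
  convex \<open>f\<close> the matching lower bound is 0.\<close>

definition second_difference_le :: "real \<Rightarrow> ('a::euclidean_space \<Rightarrow> real) \<Rightarrow> bool" where
  "second_difference_le K f \<longleftrightarrow> (\<forall>x h. f (x + h) + f (x - h) - 2 * f x \<le> K * (norm h)\<^sup>2)"

text \<open>Translates of \<open>f\<close> satisfy the same inequalities, and integration is
  monotone. The unchanged constant is what allows the one-step estimate to be iterated.\<close>

lemma lipschitz_convex_gauss_average:
  fixes f :: "'a::euclidean_space \<Rightarrow> real"
  assumes v: "v > 0" and L: "L \<ge> 0" and f: "lipschitz_convex L f"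
  shows "lipschitz_convex L (\<lambda>x. \<integral>y. f (x + y) \<partial>gauss v)"
proof -
  interpret prob_space "gauss v :: 'a measure" by (rule prob_space_gauss[OF v])
  note int = integrable_lipschitz_gauss(1)[OF v L f]
  note D = lipschitz_convexD[OF f]
  show ?thesis
    unfolding lipschitz_convex_def
  proof (intro conjI allI convex_onI)
    fix x z :: 'a
    have "\<bar>(\<integral>y. f (x + y) \<partial>gauss v) - (\<integral>y. f (z + y) \<partial>gauss v)\<bar> = \<bar>\<integral>y. f (x + y) - f (z + y) \<partial>gauss v\<bar>"
      by (simp add: int)
    also have "\<dots> \<le> (\<integral>y. \<bar>f (x + y) - f (z + y)\<bar> \<partial>gauss v)"
      by (rule integral_abs_bound)
    also have "\<dots> \<le> (\<integral>y. L * norm (x - z) \<partial>(gauss v :: 'a measure))"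
    proof (rule integral_mono)
      show "integrable (gauss v) (\<lambda>y. \<bar>f (x + y) - f (z + y)\<bar>)"
        by (intro integrable_abs Bochner_Integration.integrable_diff int)
      show "\<bar>f (x + y) - f (z + y)\<bar> \<le> L * norm (x - z)" for y
        using D(2)[of "x + y" "z + y"] by simp
    qed simp
    also have "\<dots> = L * norm (x - z)"
      by (simp add: prob_space[simplified])
    finally show "\<bar>(\<integral>y. f (x + y) \<partial>gauss v) - (\<integral>y. f (z + y) \<partial>gauss v)\<bar> \<le> L * norm (x - z)" .
  next
    fix t :: real and x z :: 'a assume t: "0 < t" "t < 1"
    have "f (((1 - t) *\<^sub>R x + t *\<^sub>R z) + y) \<le> (1 - t) * f (x + y) + t * f (z + y)" for y
    proof -
      have "((1 - t) *\<^sub>R x + t *\<^sub>R z) + y = (1 - t) *\<^sub>R (x + y) + t *\<^sub>R (z + y)"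
        by (simp add: algebra_simps)
      then show ?thesis
        using convex_onD[OF D(1), of t "x + y" "z + y"] t by simp
    qed
    then have "(\<integral>y. f (((1 - t) *\<^sub>R x + t *\<^sub>R z) + y) \<partial>gauss v) \<le> (\<integral>y. (1 - t) * f (x + y) + t * f (z + y) \<partial>gauss v)"
      by (intro integral_mono Bochner_Integration.integrable_add integrable_mult_right int)
    then show "(\<integral>y. f (((1 - t) *\<^sub>R x + t *\<^sub>R z) + y) \<partial>gauss v) \<le>
      (1 - t) * (\<integral>y. f (x + y) \<partial>gauss v) + t * (\<integral>y. f (z + y) \<partial>gauss v)"
      by (simp add: int)
  qed simp
qed

lemma second_difference_le_gauss_average:
  fixes f :: "'a::euclidean_space \<Rightarrow> real"
  assumes v: "v > 0" and L: "L \<ge> 0" and f: "lipschitz_convex L f" and K: "second_difference_le K f"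
  shows "second_difference_le K (\<lambda>x. \<integral>y. f (x + y) \<partial>gauss v)"
  unfolding second_difference_le_def
proof (intro allI)
  interpret prob_space "gauss v :: 'a measure" by (rule prob_space_gauss[OF v])
  note int = integrable_lipschitz_gauss(1)[OF v L f]
  fix x h :: 'a
  have "(\<integral>y. f ((x + h) + y) + f ((x - h) + y) - 2 * f (x + y) \<partial>gauss v) \<le> (\<integral>y. K * (norm h)\<^sup>2 \<partial>(gauss v :: 'a measure))"
  proof (rule integral_mono)
    show "integrable (gauss v) (\<lambda>y. f ((x + h) + y) + f ((x - h) + y) - 2 * f (x + y))"
      by (intro Bochner_Integration.integrable_add Bochner_Integration.integrable_diff integrable_mult_right int)
    show "f ((x + h) + y) + f ((x - h) + y) - 2 * f (x + y) \<le> K * (norm h)\<^sup>2" for y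
      using K[unfolded second_difference_le_def, rule_format, of "x + y" h] by (simp add: algebra_simps)
  qed simp
  then show "(\<integral>y. f ((x + h) + y) \<partial>gauss v) + (\<integral>y. f ((x - h) + y) \<partial>gauss v) - 2 * (\<integral>y. f (x + y) \<partial>gauss v) \<le> K * (norm h)\<^sup>2"
    by (simp add: int prob_space[simplified])
qed

section \<open>The exponential moment over a small variance, and its iteration\<close>

lemma exp_le_quadratic:
  fixes y :: real
  shows "exp y \<le> 1 + y + y\<^sup>2 / 2 + \<bar>y\<bar> ^ 3 / 6 * exp \<bar>y\<bar>"
proof -
  obtain t where t: "\<bar>t\<bar> \<le> \<bar>y\<bar>" and e: "exp y = (\<Sum>m<3. y ^ m / fact m) + exp t / fact 3 * y ^ 3"
    using Maclaurin_exp_le[of y 3] by auto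
  have "exp t * y ^ 3 \<le> exp \<bar>y\<bar> * \<bar>y\<bar> ^ 3"
    using t abs_ge_self[of "y ^ 3"]
    by (intro order_trans[OF mult_left_mono mult_right_mono]) (auto simp: power_abs)
  then show ?thesis
    by (simp add: e eval_nat_numeral fact_numeral mult.commute)
qed

text \<open>Any subgradient \<open>w\<close> at \<open>x\<close> works. Its inequality at
  \<open>h = w\<close> bounds its norm by \<open>L\<close>; its inequality at \<open>- h\<close>,
  inserted into the second difference, bounds the remainder at \<open>h\<close> from above.\<close>

lemma gradient_bounds:
  fixes f :: "'a::euclidean_space \<Rightarrow> real"
  assumes L: "L \<ge> 0" and f: "lipschitz_convex L f" and K: "second_difference_le K f"
  obtains w where "norm w \<le> L" "\<And>h. 0 \<le> f (x + h) - f x - w \<bullet> h"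
    "\<And>h. f (x + h) - f x - w \<bullet> h \<le> K * (norm h)\<^sup>2"
proof -
  obtain w where w: "\<And>h. f x + w \<bullet> h \<le> f (x + h)"
    using subgradient_exists[OF lipschitz_convexD(1)[OF f]] by blast
  have "(norm w)\<^sup>2 \<le> L * norm w"
    using w[of w] lipschitz_convexD(2)[OF f, of "x + w" x] by (simp add: power2_norm_eq_inner)
  then have "norm w \<le> L"
    using L by (cases "w = 0") (auto simp: power2_eq_square)
  moreover have "f (x + h) - f x - w \<bullet> h \<le> K * (norm h)\<^sup>2" for h
    using w[of "- h"] K[unfolded second_difference_le_def, rule_format, of x h] by simp
  ultimately show ?thesis
    using w that by (simp add: algebra_simps)
qed

text \<open>Expand the exponential after centring. The first-order term vanishes; the second-order
  term is governed by the affine part of \<open>f\<close>, whose slope is at most \<open>L\<close>,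
  up to an error of order \<open>s ^ 3\<close>; the remainder has that order too. The point is that
  \<open>C\<close> is chosen before \<open>f\<close>, \<open>x\<close> and \<open>s\<close>.\<close>

lemma small_variance_step:
  fixes L K l :: real
  assumes L: "L \<ge> 0" and K: "K \<ge> 0"
  obtains C where "C \<ge> 0" and
    "\<And>(f :: 'a::euclidean_space \<Rightarrow> real) x s. lipschitz_convex L f \<Longrightarrow> second_difference_le K f \<Longrightarrow> 0 < s \<Longrightarrow> s \<le> 1 \<Longrightarrow>
      (\<integral>y. exp (l * f (x + y)) \<partial>gauss (s\<^sup>2)) \<le>
        (1 + l\<^sup>2 * L\<^sup>2 * s\<^sup>2 / 2 + C * s ^ 3) * exp (l * (\<integral>y. f (x + y) \<partial>gauss (s\<^sup>2)))"
proof
  interpret G: prob_space "gauss 1 :: 'a measure" by (rule prob_space_gauss) simp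
  define m where "m = (\<integral>y. norm y \<partial>(gauss 1 :: 'a measure))"
  define m3 where "m3 = (\<integral>y. norm y ^ 3 \<partial>(gauss 1 :: 'a measure))"
  \<comment> \<open>\<open>s * B y\<close> will dominate the centred exponent \<open>Y y\<close>,
    with \<open>B\<close> free of \<open>f\<close>, \<open>x\<close> and \<open>s\<close>. The
    factor 2 in \<open>E\<close> leaves one \<open>exp (B y)\<close> for the cube in the Taylor
    remainder and one for the exponential next to it.\<close>
  define B where "B = (\<lambda>y::'a. \<bar>l\<bar> * L * (norm y + m))"
  define E where "E = (\<integral>y. exp (2 * B y) \<partial>gauss 1)"
  have m: "m \<ge> 0" and m3: "m3 \<ge> 0" and E: "E \<ge> 0"
    unfolding m_def m3_def E_def by (auto intro!: Bochner_Integration.integral_nonneg)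
  have B0: "B y \<ge> 0" for y
    using L m by (simp add: B_def)
  have intB: "integrable (gauss 1) (\<lambda>y::'a. exp (2 * B y))"
  proof (rule integrable_gauss_bound)
    show "\<bar>exp (2 * B y)\<bar> \<le> exp (2 * \<bar>l\<bar> * L * m) * exp ((2 * \<bar>l\<bar> * L) * norm y)" for y
      by (simp add: B_def distrib_left mult.assoc flip: exp_add)
  qed (auto simp: B_def)
  have intn: "integrable (gauss 1) (\<lambda>y::'a. norm y)"
    using integrable_gauss_norm_power[of 1 1, where 'a='a] by simp
  show "0 \<le> l\<^sup>2 * K * L * m3 + E"
    using L K m3 E by simp
  fix f :: "'a \<Rightarrow> real" and x :: 'a and s :: real
  assume f: "lipschitz_convex L f" and sd: "second_difference_le K f" and s: "0 < s" "s \<le> 1"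
  note [measurable] = lipschitz_convex_measurable[OF f]
  \<comment> \<open>Rescaling to unit variance turns \<open>s\<close> into an explicit factor of the
    argument, so that its powers can be read off.\<close>
  have sc: "gauss (s\<^sup>2) = distr (gauss 1) borel (\<lambda>y::'a. s *\<^sub>R y)"
    using gauss_scale[OF s(1), of 1, where 'a='a] by simp
  define D where "D = (\<lambda>y. f (x + s *\<^sub>R y) - f x)"
  have [measurable]: "D \<in> borel_measurable borel"
    unfolding D_def by measurable
  have Dle: "\<bar>D y\<bar> \<le> L * s * norm y" for y
    using lipschitz_convexD(2)[OF f, of "x + s *\<^sub>R y" x] s by (simp add: D_def mult.assoc)
  have intD: "integrable (gauss 1) D"
    by (rule Bochner_Integration.integrable_bound[OF integrable_mult_right[OF intn, of "L * s"]])
       (use L s Dle in \<open>auto simp: abs_mult\<close>)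
  define d where "d = (\<integral>y. D y \<partial>gauss 1)"
  have mean: "(\<integral>y. f (x + y) \<partial>gauss (s\<^sup>2)) = f x + d"
  proof -
    have "(\<integral>y. f (x + y) \<partial>gauss (s\<^sup>2)) = (\<integral>y. f x + D y \<partial>gauss 1)"
      unfolding sc by (subst integral_distr) (auto simp: D_def)
    then show ?thesis
      using intD by (simp add: d_def G.prob_space[simplified])
  qed
  have "\<bar>d\<bar> \<le> L * s * m"
  proof -
    have "\<bar>d\<bar> \<le> (\<integral>y. \<bar>D y\<bar> \<partial>gauss 1)"
      unfolding d_def by (rule integral_abs_bound)
    also have "\<dots> \<le> (\<integral>y. L * s * norm y \<partial>(gauss 1 :: 'a measure))"
      by (intro integral_mono integrable_abs intD integrable_mult_right intn Dle)
    finally show ?thesis by (simp add: m_def)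
  qed
  define Y where "Y = (\<lambda>y. l * (D y - d))"
  have Yle: "\<bar>Y y\<bar> \<le> s * B y" for y
  proof -
    have "\<bar>D y - d\<bar> \<le> L * s * norm y + L * s * m"
      using Dle[of y] \<open>\<bar>d\<bar> \<le> L * s * m\<close> by linarith
    then have "\<bar>l\<bar> * \<bar>D y - d\<bar> \<le> \<bar>l\<bar> * (L * s * norm y + L * s * m)"
      by (rule mult_left_mono) simp
    then show ?thesis
      unfolding Y_def abs_mult by (simp add: B_def algebra_simps)
  qed
  have intY: "integrable (gauss 1) Y"
    unfolding Y_def by (intro integrable_mult_right Bochner_Integration.integrable_diff intD) simp
  have intD2: "integrable (gauss 1) (\<lambda>y. (D y)\<^sup>2)"
  proof (rule Bochner_Integration.integrable_bound)
    show "integrable (gauss 1) (\<lambda>y::'a. (L * s)\<^sup>2 * norm y ^ 2)"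
      by (intro integrable_mult_right integrable_gauss_norm_power) simp
    show "AE y in gauss 1. norm ((D y)\<^sup>2) \<le> norm ((L * s)\<^sup>2 * norm y ^ 2)"
      using power_mono[OF Dle abs_ge_zero, of _ 2] by (simp add: power_mult_distrib)
  qed simp
  have intY2: "integrable (gauss 1) (\<lambda>y. (Y y)\<^sup>2)"
  proof -
    have "(\<lambda>y. (Y y)\<^sup>2) = (\<lambda>y. l\<^sup>2 * ((D y)\<^sup>2 - 2 * d * D y + d\<^sup>2))"
      unfolding Y_def power_mult_distrib power2_diff by (simp add: algebra_simps)
    then show ?thesis
      using intD intD2 by simp
  qed
  obtain w where w: "norm w \<le> L" and R0: "\<And>h. 0 \<le> f (x + h) - f x - w \<bullet> h"
    and R: "\<And>h. f (x + h) - f x - w \<bullet> h \<le> K * (norm h)\<^sup>2"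
    using gradient_bounds[OF L f sd] by blast
  have ED2: "(\<integral>y. (D y)\<^sup>2 \<partial>gauss 1) \<le> L\<^sup>2 * s\<^sup>2 + 2 * K * L * s ^ 3 * m3"
  proof -
    \<comment> \<open>A difference of squares:
      \<open>(D y)\<^sup>2 - (s * (w \<bullet> y))\<^sup>2\<close> is \<open>r\<close> times
      \<open>D y + s * (w \<bullet> y)\<close>, where \<open>r\<close> has order
      \<open>s\<^sup>2\<close> through \<open>K\<close> and the other factor has order
      \<open>s\<close> through \<open>L\<close>.\<close>
    have le: "(D y)\<^sup>2 \<le> s\<^sup>2 * (w \<bullet> y)\<^sup>2 + 2 * K * L * s ^ 3 * norm y ^ 3" for y
    proof -
      define r where "r = D y - s * (w \<bullet> y)"
      have r: "0 \<le> r" "r \<le> K * (s\<^sup>2 * (norm y)\<^sup>2)"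
        using R0[of "s *\<^sub>R y"] R[of "s *\<^sub>R y"] by (auto simp: r_def D_def power_mult_distrib)
      have "\<bar>s * (w \<bullet> y)\<bar> \<le> L * s * norm y"
      proof -
        have "\<bar>w \<bullet> y\<bar> \<le> norm w * norm y" by (rule Cauchy_Schwarz_ineq2)
        also have "\<dots> \<le> L * norm y" using w by (intro mult_right_mono) auto
        finally show ?thesis using s by (simp add: abs_mult mult.assoc mult.left_commute)
      qed
      then have "D y + s * (w \<bullet> y) \<le> 2 * (L * s * norm y)"
        using Dle[of y] by linarith
      then have "r * (D y + s * (w \<bullet> y)) \<le> r * (2 * (L * s * norm y))"
        using r(1) by (rule mult_left_mono)
      also have "\<dots> \<le> K * (s\<^sup>2 * (norm y)\<^sup>2) * (2 * (L * s * norm y))"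
        using r(2) L s by (intro mult_right_mono) auto
      also have "\<dots> = 2 * K * L * s ^ 3 * norm y ^ 3"
        by (simp add: power2_eq_square power3_eq_cube)
      finally show ?thesis
        by (simp add: r_def power2_eq_square algebra_simps)
    qed
    have intw: "integrable (gauss 1) (\<lambda>y. (w \<bullet> y)\<^sup>2)"
    proof (rule Bochner_Integration.integrable_bound)
      show "integrable (gauss 1) (\<lambda>y::'a. (norm w)\<^sup>2 * norm y ^ 2)"
        by (intro integrable_mult_right integrable_gauss_norm_power) simp
      show "AE y in gauss 1. norm ((w \<bullet> y)\<^sup>2) \<le> norm ((norm w)\<^sup>2 * norm y ^ 2)"
        using power_mono[OF Cauchy_Schwarz_ineq2 abs_ge_zero, of w _ 2] by (simp add: power_mult_distrib)
    qed simp
    note int3 = integrable_gauss_norm_power[of 1 3, where 'a='a, simplified]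
    have "(\<integral>y. (D y)\<^sup>2 \<partial>gauss 1) \<le> (\<integral>y. s\<^sup>2 * (w \<bullet> y)\<^sup>2 + 2 * K * L * s ^ 3 * norm y ^ 3 \<partial>gauss 1)"
      by (intro integral_mono intD2 Bochner_Integration.integrable_add integrable_mult_right intw int3 le)
    also have "\<dots> = s\<^sup>2 * (\<integral>y. (w \<bullet> y)\<^sup>2 \<partial>gauss 1) + 2 * K * L * s ^ 3 * m3"
      using intw int3 by (simp add: m3_def)
    also have "\<dots> \<le> s\<^sup>2 * L\<^sup>2 + 2 * K * L * s ^ 3 * m3"
      using integral_gauss_inner_square[of 1 w] power_mono[OF w norm_ge_zero, of 2]
      by (simp add: mult_left_mono)
    finally show ?thesis
      by (simp add: mult.commute)
  qed
  \<comment> \<open>Centring only lowers the second moment: \<open>d\<^sup>2\<close> is subtracted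
    and then dropped.\<close>
  have EY2: "(\<integral>y. (Y y)\<^sup>2 \<partial>gauss 1) \<le> l\<^sup>2 * (L\<^sup>2 * s\<^sup>2 + 2 * K * L * s ^ 3 * m3)"
  proof -
    have "(\<integral>y. (Y y)\<^sup>2 \<partial>gauss 1) = (\<integral>y. l\<^sup>2 * ((D y)\<^sup>2 - 2 * d * D y + d\<^sup>2) \<partial>gauss 1)"
      unfolding Y_def power_mult_distrib power2_diff by (simp add: algebra_simps)
    also have "\<dots> = l\<^sup>2 * ((\<integral>y. (D y)\<^sup>2 \<partial>gauss 1) - d\<^sup>2)"
      using intD intD2 by (simp add: G.prob_space[simplified] power2_eq_square flip: d_def)
    also have "\<dots> \<le> l\<^sup>2 * (L\<^sup>2 * s\<^sup>2 + 2 * K * L * s ^ 3 * m3)"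
      using ED2 by (intro mult_left_mono) (auto intro: order_trans[rotated])
    finally show ?thesis .
  qed
  have "(\<integral>y. exp (Y y) \<partial>gauss 1) \<le> (\<integral>y. 1 + Y y + (Y y)\<^sup>2 / 2 + s ^ 3 * exp (2 * B y) \<partial>gauss 1)"
  proof (rule integral_mono)
    show "exp (Y y) \<le> 1 + Y y + (Y y)\<^sup>2 / 2 + s ^ 3 * exp (2 * B y)" for y
    proof -
      \<comment> \<open>The 6 is the factorial from \<open>power_le_fact_mult_exp\<close> with
        exponent 3; it cancels the 6 of the Taylor remainder.\<close>
      have "\<bar>Y y\<bar> ^ 3 \<le> (s * B y) ^ 3"
        by (intro power_mono Yle) simp
      also have "\<dots> \<le> s ^ 3 * (6 * exp (B y))"
        using s power_le_fact_mult_exp[OF B0[of y], of 3] by (simp add: power_mult_distrib fact_numeral)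
      finally have a: "\<bar>Y y\<bar> ^ 3 / 6 \<le> s ^ 3 * exp (B y)" by simp
      \<comment> \<open>Here \<open>s \<le> 1\<close> enters, to discard the factor \<open>s\<close>
        in \<open>s * B y\<close>.\<close>
      have b: "exp \<bar>Y y\<bar> \<le> exp (B y)"
        using order_trans[OF Yle[of y] mult_left_le_one_le[OF B0]] s by simp
      have "\<bar>Y y\<bar> ^ 3 / 6 * exp \<bar>Y y\<bar> \<le> s ^ 3 * exp (B y) * exp (B y)"
        using s by (intro mult_mono a b) auto
      also have "\<dots> = s ^ 3 * exp (2 * B y)"
        by (simp add: mult.assoc flip: exp_add)
      finally show ?thesis
        using exp_le_quadratic[of "Y y"] by linarith
    qed
    show "integrable (gauss 1) (\<lambda>y. exp (Y y))"
    proof (rule Bochner_Integration.integrable_bound[OF intB])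
      have "Y y \<le> 2 * B y" for y
        using order_trans[OF Yle[of y] mult_left_le_one_le[OF B0]] B0[of y] s by simp
      then show "AE y in gauss 1. norm (exp (Y y)) \<le> norm (exp (2 * B y))"
        by simp
    qed (simp add: Y_def)
  qed (intro Bochner_Integration.integrable_add integrable_divide intY intY2 integrable_mult_right intB, simp)
  also have "\<dots> = 1 + (\<integral>y. (Y y)\<^sup>2 \<partial>gauss 1) / 2 + s ^ 3 * E"
  proof -
    have "(\<integral>y. Y y \<partial>gauss 1) = 0"
      using intD by (simp add: Y_def G.prob_space[simplified] flip: d_def)
    then show ?thesis
      using intY intY2 intB by (simp add: G.prob_space[simplified] E_def)
  qed
  also have "\<dots> \<le> 1 + l\<^sup>2 * (L\<^sup>2 * s\<^sup>2 + 2 * K * L * s ^ 3 * m3) / 2 + s ^ 3 * E"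
    using EY2 by simp
  also have "\<dots> = 1 + l\<^sup>2 * L\<^sup>2 * s\<^sup>2 / 2 + (l\<^sup>2 * K * L * m3 + E) * s ^ 3"
    by (simp add: algebra_simps)
  finally have main: "(\<integral>y. exp (Y y) \<partial>gauss 1) \<le> 1 + l\<^sup>2 * L\<^sup>2 * s\<^sup>2 / 2 + (l\<^sup>2 * K * L * m3 + E) * s ^ 3" .
  have "(\<integral>y. exp (l * f (x + y)) \<partial>gauss (s\<^sup>2)) = (\<integral>y. exp (Y y) * exp (l * (f x + d)) \<partial>gauss 1)"
    unfolding sc by (subst integral_distr) (auto simp: Y_def D_def algebra_simps simp flip: exp_add)
  also have "\<dots> = (\<integral>y. exp (Y y) \<partial>gauss 1) * exp (l * (f x + d))"
    by simp
  also have "\<dots> \<le> (1 + l\<^sup>2 * L\<^sup>2 * s\<^sup>2 / 2 + (l\<^sup>2 * K * L * m3 + E) * s ^ 3) * exp (l * (f x + d))"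
    by (intro mult_right_mono main) simp
  finally show "(\<integral>y. exp (l * f (x + y)) \<partial>gauss (s\<^sup>2)) \<le>
        (1 + l\<^sup>2 * L\<^sup>2 * s\<^sup>2 / 2 + (l\<^sup>2 * K * L * m3 + E) * s ^ 3) * exp (l * (\<integral>y. f (x + y) \<partial>gauss (s\<^sup>2)))"
    unfolding mean .
qed

text \<open>For one more step, integrate first over variance \<open>t\<close>: the induction
  hypothesis at the translated point replaces the inner exponential moment by the exponential of the
  average \<open>F\<close>. As \<open>F\<close> lies in the same class as \<open>f\<close>,
  \<open>step\<close> applies to it. Counting by \<open>Suc k\<close> keeps the variance
  positive.\<close>

lemma gauss_iterate:
  fixes f :: "'a::euclidean_space \<Rightarrow> real"
  assumes e: "e > 0" and L: "L \<ge> 0" and a: "a \<ge> 0"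
    and step: "\<And>(f :: 'a \<Rightarrow> real) x. lipschitz_convex L f \<Longrightarrow> second_difference_le K f \<Longrightarrow>
      (\<integral>y. exp (l * f (x + y)) \<partial>gauss e) \<le> a * exp (l * (\<integral>y. f (x + y) \<partial>gauss e))"
    and f: "lipschitz_convex L f" and sd: "second_difference_le K f"
  shows "(\<integral>y. exp (l * f (x + y)) \<partial>gauss (real (Suc k) * e)) \<le>
    a ^ Suc k * exp (l * (\<integral>y. f (x + y) \<partial>gauss (real (Suc k) * e)))"
proof (induction k arbitrary: x)
  case 0
  then show ?case using step[OF f sd] by simp
next
  case (Suc k)
  define t where "t = real (Suc k) * e"
  have t: "t > 0" using e by (simp add: t_def)
  have te: "real (Suc (Suc k)) * e = t + e" by (simp add: t_def algebra_simps)
  have te0: "t + e > 0" using t e by simp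
  define F where "F = (\<lambda>x. \<integral>y. f (x + y) \<partial>gauss t)"
  have F: "lipschitz_convex L F" "second_difference_le K F"
    unfolding F_def using lipschitz_convex_gauss_average[OF t L f] second_difference_le_gauss_average[OF t L f sd] .
  have [measurable]: "f \<in> borel_measurable borel" by (rule lipschitz_convex_measurable[OF f])
  have mean: "(\<integral>y. F (x + y) \<partial>gauss e) = (\<integral>y. f (x + y) \<partial>gauss (t + e))"
    using integral_gauss_add[OF t e integrable_lipschitz_gauss(1)[OF te0 L f, of x]]
    by (simp add: F_def add.assoc add.commute add.left_commute)
  have "(\<integral>y. exp (l * f (x + y)) \<partial>gauss (t + e)) =
      (\<integral>z. (\<integral>y. exp (l * f (x + (y + z))) \<partial>gauss t) \<partial>gauss e)"
    using integral_gauss_add[OF t e integrable_lipschitz_gauss(2)[OF te0 L f, of l x]] by simp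
  also have "\<dots> \<le> (\<integral>z. a ^ Suc k * exp (l * F (x + z)) \<partial>gauss e)"
  proof (rule integral_mono')
    show "integrable (gauss e) (\<lambda>z. a ^ Suc k * exp (l * F (x + z)))"
      by (intro integrable_mult_right integrable_lipschitz_gauss(2)[OF e L F(1)])
    show "(\<integral>y. exp (l * f (x + (y + z))) \<partial>gauss t) \<le> a ^ Suc k * exp (l * F (x + z))" for z
      using Suc.IH[of "x + z"] by (simp add: F_def t_def add.assoc add.commute add.left_commute)
  qed (use a in auto)
  also have "\<dots> = a ^ Suc k * (\<integral>z. exp (l * F (x + z)) \<partial>gauss e)"
    by simp
  also have "\<dots> \<le> a ^ Suc k * (a * exp (l * (\<integral>z. F (x + z) \<partial>gauss e)))"
    by (intro mult_left_mono step F) (use a in auto)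
  finally show ?case
    unfolding te mean by (simp add: mult.assoc mult.left_commute)
qed

section \<open>Gaussian concentration\<close>

text \<open>With \<open>N = Suc k\<close> steps of variance \<open>s\<^sup>2 = v / N\<close>, the
  accumulated factor is \<open>a ^ N \<le> exp (N * (a - 1))\<close>. Its exponent exceeds
  \<open>l\<^sup>2 * L\<^sup>2 * v / 2\<close> by \<open>C * v * s\<close>, which vanishes as
  \<open>N\<close> grows.\<close>

lemma integral_exp_gauss_le_smooth:
  fixes f :: "'a::euclidean_space \<Rightarrow> real"
  assumes v: "v > 0" and L: "L \<ge> 0" and K: "K \<ge> 0"
    and f: "lipschitz_convex L f" and sd: "second_difference_le K f"
  shows "(\<integral>y. exp (l * f y) \<partial>gauss v) \<le> exp (l\<^sup>2 * L\<^sup>2 * v / 2 + l * (\<integral>y. f y \<partial>gauss v))"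
proof -
  obtain C where C: "C \<ge> 0" and step: "\<And>(f :: 'a \<Rightarrow> real) x s. lipschitz_convex L f \<Longrightarrow> second_difference_le K f \<Longrightarrow> 0 < s \<Longrightarrow> s \<le> 1 \<Longrightarrow>
      (\<integral>y. exp (l * f (x + y)) \<partial>gauss (s\<^sup>2)) \<le>
        (1 + l\<^sup>2 * L\<^sup>2 * s\<^sup>2 / 2 + C * s ^ 3) * exp (l * (\<integral>y. f (x + y) \<partial>gauss (s\<^sup>2)))"
    using small_variance_step[OF L K, of l, where 'a='a] by blast
  define E where "E = (\<integral>y. f y \<partial>gauss v)"
  let ?b = "\<lambda>k. l\<^sup>2 * L\<^sup>2 * v / 2 + C * v * sqrt (v / real (Suc k))"
  \<comment> \<open>The condition on \<open>k\<close> says \<open>s \<le> 1\<close>, as the one-step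
    estimate requires.\<close>
  have bound: "(\<integral>y. exp (l * f y) \<partial>gauss v) \<le> exp (?b k) * exp (l * E)" if k: "real (Suc k) \<ge> v" for k
  proof -
    define s where "s = sqrt (v / real (Suc k))"
    have s: "0 < s" "s \<le> 1" using v k by (auto simp: s_def)
    have s2: "s\<^sup>2 = v / real (Suc k)" using v by (simp add: s_def)
    have Ns2: "real (Suc k) * s\<^sup>2 = v" by (simp add: s2)
    define a where "a = 1 + l\<^sup>2 * L\<^sup>2 * s\<^sup>2 / 2 + C * s ^ 3"
    have a: "a \<ge> 0" using C s by (simp add: a_def)
    have "(\<integral>y. exp (l * f (0 + y)) \<partial>gauss (real (Suc k) * s\<^sup>2)) \<le>
        a ^ Suc k * exp (l * (\<integral>y. f (0 + y) \<partial>gauss (real (Suc k) * s\<^sup>2)))"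
      using s by (intro gauss_iterate[OF _ L a _ f sd]) (auto simp: a_def intro!: step)
    then have "(\<integral>y. exp (l * f y) \<partial>gauss v) \<le> a ^ Suc k * exp (l * E)"
      unfolding Ns2 by (simp add: E_def)
    also have "a ^ Suc k \<le> exp (?b k)"
    proof -
      have "a ^ Suc k \<le> exp (a - 1) ^ Suc k"
        using exp_ge_add_one_self[of "a - 1"] by (intro power_mono a) simp
      also have "\<dots> = exp (real (Suc k) * (a - 1))"
        by (rule exp_of_nat_mult[symmetric])
      also have "real (Suc k) * (a - 1) = l\<^sup>2 * L\<^sup>2 * (real (Suc k) * s\<^sup>2) / 2 + C * (real (Suc k) * s\<^sup>2) * s"
        by (simp add: a_def power2_eq_square power3_eq_cube algebra_simps)
      finally show ?thesis
        unfolding Ns2 by (simp add: s_def)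
    qed
    finally show ?thesis by (simp add: mult_right_mono)
  qed
  have "(\<lambda>k. ?b k) \<longlonglongrightarrow> l\<^sup>2 * L\<^sup>2 * v / 2 + C * v * sqrt 0"
  proof (intro tendsto_intros)
    show "(\<lambda>k. v / real (Suc k)) \<longlonglongrightarrow> 0"
      using LIMSEQ_Suc[OF lim_const_over_n[of v]] by simp
  qed
  then have "(\<lambda>k. exp (?b k) * exp (l * E)) \<longlonglongrightarrow> exp (l\<^sup>2 * L\<^sup>2 * v / 2) * exp (l * E)"
    by (intro tendsto_intros) simp
  moreover have "\<forall>\<^sub>F k in sequentially. (\<integral>y. exp (l * f y) \<partial>gauss v) \<le> exp (?b k) * exp (l * E)"
    using eventually_ge_at_top[of "nat \<lceil>v\<rceil>"]
  proof eventually_elim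
    case (elim k)
    then show ?case by (intro bound) linarith
  qed
  ultimately have "(\<integral>y. exp (l * f y) \<partial>gauss v) \<le> exp (l\<^sup>2 * L\<^sup>2 * v / 2) * exp (l * E)"
    by (rule tendsto_lowerbound) simp
  then show ?thesis
    by (simp add: E_def exp_add)
qed

text \<open>The envelope is the infimal convolution of \<open>f\<close> with
  \<open>(norm x)\<^sup>2 / (2 * \<eta>)\<close>. For the second difference, a near-minimizer at
  \<open>x\<close> serves as competitor at both \<open>x + h\<close> and \<open>x - h\<close>, and
  the parallelogram law evaluates the two quadratic terms.\<close>

lemma Moreau_envelope:
  fixes f :: "'a::euclidean_space \<Rightarrow> real"
  assumes f: "lipschitz_convex L f" and eta: "\<eta> > 0"
  obtains g where "lipschitz_convex L g" "second_difference_le (1 / \<eta>) g"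
    "\<And>x. g x \<le> f x" "\<And>x. f x \<le> g x + L\<^sup>2 * \<eta> / 2"
proof
  define A where "A = (\<lambda>x y. f y + (norm (x - y))\<^sup>2 / (2 * \<eta>))"
  define g where "g = (\<lambda>x. INF y. A x y)"
  \<comment> \<open>The largest value of \<open>L * t - t\<^sup>2 / (2 * \<eta>)\<close> is
    \<open>L\<^sup>2 * \<eta> / 2\<close>, at \<open>t = L * \<eta>\<close>. The same bound makes
    the infimum finite.\<close>
  have Age: "f x - L\<^sup>2 * \<eta> / 2 \<le> A x y" for x y
  proof -
    define t where "t = norm (x - y)"
    have "0 \<le> (t - L * \<eta>)\<^sup>2 / (2 * \<eta>)" using eta by simp
    also have "\<dots> = t\<^sup>2 / (2 * \<eta>) - L * t + L\<^sup>2 * \<eta> / 2"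
      using eta by (simp add: power2_diff power2_eq_square field_simps)
    finally show ?thesis
      using lipschitz_convexD(2)[OF f, of x y] by (simp add: A_def t_def)
  qed
  have bdd: "bdd_below (range (A x))" for x
    using Age[of x] by (intro bdd_belowI2)
  have gle: "g x \<le> A x y" for x y
    unfolding g_def by (rule cINF_lower[OF bdd]) simp
  \<comment> \<open>Near-minimizers are used in place of minimizers; \<open>field_le_epsilon\<close>
    removes the slack in each argument.\<close>
  have approx: "\<exists>y. A x y < g x + e" if "e > 0" for x e
    using that cINF_less_iff[OF _ bdd, of x "g x + e"] by (auto simp: g_def)
  show "g x \<le> f x" for x
    using gle[of x x] by (simp add: A_def)
  show "f x \<le> g x + L\<^sup>2 * \<eta> / 2" for x
  proof -
    have "f x - L\<^sup>2 * \<eta> / 2 \<le> g x"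
      unfolding g_def using Age by (intro cINF_greatest) auto
    then show ?thesis by simp
  qed
  show "second_difference_le (1 / \<eta>) g"
    unfolding second_difference_le_def
  proof (intro allI)
    fix x h :: 'a
    show "g (x + h) + g (x - h) - 2 * g x \<le> 1 / \<eta> * (norm h)\<^sup>2"
    proof (rule field_le_epsilon)
      fix e :: real assume "e > 0"
      then obtain y where y: "A x y < g x + e / 2" using approx[of "e / 2" x] by auto
      have "(norm (x + h - y))\<^sup>2 + (norm (x - h - y))\<^sup>2 = 2 * (norm (x - y))\<^sup>2 + 2 * (norm h)\<^sup>2"
        unfolding power2_norm_eq_inner by (simp add: inner_simps inner_commute)
      then have "(norm (x + h - y))\<^sup>2 / (2 * \<eta>) + (norm (x - h - y))\<^sup>2 / (2 * \<eta>) = 2 * ((norm (x - y))\<^sup>2 / (2 * \<eta>)) + (norm h)\<^sup>2 / \<eta>"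
        using eta by (simp add: divide_simps)
      then have "A (x + h) y + A (x - h) y = 2 * A x y + 1 / \<eta> * (norm h)\<^sup>2"
        by (simp add: A_def)
      then show "g (x + h) + g (x - h) - 2 * g x \<le> 1 / \<eta> * (norm h)\<^sup>2 + e"
        using y gle[of "x + h" y] gle[of "x - h" y] by linarith
    qed
  qed
  have lip: "g x \<le> g z + L * norm (x - z)" for x z
  proof (rule field_le_epsilon)
    fix e :: real assume "e > 0"
    then obtain y where y: "A z y < g z + e" using approx by blast
    \<comment> \<open>Moving the competitor along with the argument leaves the quadratic term
      unchanged, so only the Lipschitz bound of \<open>f\<close> enters.\<close>
    have "A x (y + (x - z)) \<le> A z y + L * norm (x - z)"
      using lipschitz_convexD(2)[OF f, of "y + (x - z)" y] by (simp add: A_def)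
    then show "g x \<le> g z + L * norm (x - z) + e"
      using y gle[of x "y + (x - z)"] by linarith
  qed
  show "lipschitz_convex L g"
    unfolding lipschitz_convex_def
  proof (intro conjI allI convex_onI)
    show "\<bar>g x - g z\<bar> \<le> L * norm (x - z)" for x z
      using lip[of x z] lip[of z x] by (simp add: norm_minus_commute abs_le_iff)
    fix t :: real and x z :: 'a assume t: "0 < t" "t < 1"
    show "g ((1 - t) *\<^sub>R x + t *\<^sub>R z) \<le> (1 - t) * g x + t * g z"
    proof (rule field_le_epsilon)
      fix e :: real assume "e > 0"
      then obtain y y' where y: "A x y < g x + e" and y': "A z y' < g z + e" using approx by blast
      \<comment> \<open>Convexity of the squared norm makes \<open>A\<close> jointly convex, and
        minimizing over one argument preserves convexity in the other.\<close>
      have sq: "(norm ((1 - t) *\<^sub>R a + t *\<^sub>R b))\<^sup>2 \<le> (1 - t) * (norm a)\<^sup>2 + t * (norm b)\<^sup>2" for a b :: 'a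
      proof -
        have "(1 - t) * (norm a)\<^sup>2 + t * (norm b)\<^sup>2 - (norm ((1 - t) *\<^sub>R a + t *\<^sub>R b))\<^sup>2 = t * (1 - t) * (norm (a - b))\<^sup>2"
          unfolding power2_norm_eq_inner by (simp add: inner_simps inner_commute algebra_simps)
        also have "\<dots> \<ge> 0" using t by simp
        finally show ?thesis by simp
      qed
      have "((1 - t) *\<^sub>R x + t *\<^sub>R z) - ((1 - t) *\<^sub>R y + t *\<^sub>R y') = (1 - t) *\<^sub>R (x - y) + t *\<^sub>R (z - y')"
        by (simp add: algebra_simps)
      then have "(norm (((1 - t) *\<^sub>R x + t *\<^sub>R z) - ((1 - t) *\<^sub>R y + t *\<^sub>R y')))\<^sup>2 / (2 * \<eta>)
          \<le> ((1 - t) * (norm (x - y))\<^sup>2 + t * (norm (z - y'))\<^sup>2) / (2 * \<eta>)"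
        using sq[of "x - y" "z - y'"] eta by (simp add: divide_right_mono)
      moreover have "f ((1 - t) *\<^sub>R y + t *\<^sub>R y') \<le> (1 - t) * f y + t * f y'"
        using convex_onD[OF lipschitz_convexD(1)[OF f], of t y y'] t by simp
      ultimately have "A ((1 - t) *\<^sub>R x + t *\<^sub>R z) ((1 - t) *\<^sub>R y + t *\<^sub>R y') \<le> (1 - t) * A x y + t * A z y'"
        by (simp add: A_def distrib_left add_divide_distrib)
      also have "\<dots> \<le> (1 - t) * (g x + e) + t * (g z + e)"
        using y y' t by (intro add_mono mult_left_mono) auto
      also have "\<dots> = (1 - t) * g x + t * g z + e"
        by (simp add: algebra_simps)
      finally show "g ((1 - t) *\<^sub>R x + t *\<^sub>R z) \<le> (1 - t) * g x + t * g z + e"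
        using gle order_trans by blast
    qed
  qed simp
qed

text \<open>The envelope is uniformly within \<open>\<delta>\<close> of \<open>f\<close>, so
  exchanging them costs \<open>\<bar>l\<bar> * \<delta>\<close> in the exponent twice: in the
  exponential moment and in the mean. The total \<open>\<bar>l\<bar> * L\<^sup>2 * \<eta>\<close>
  tends to 0 with \<eta>.\<close>

lemma integral_exp_gauss_le:
  fixes f :: "'a::euclidean_space \<Rightarrow> real"
  assumes v: "v > 0" and L: "L \<ge> 0" and f: "lipschitz_convex L f"
  shows "(\<integral>y. exp (l * f y) \<partial>gauss v) \<le> exp (l\<^sup>2 * L\<^sup>2 * v / 2 + l * (\<integral>y. f y \<partial>gauss v))"
proof -
  interpret prob_space "gauss v :: 'a measure" by (rule prob_space_gauss[OF v])
  define I where "I = l\<^sup>2 * L\<^sup>2 * v / 2 + l * (\<integral>y. f y \<partial>gauss v)"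
  note int = integrable_lipschitz_gauss(1)[OF v L, of _ 0, simplified]
  note inte = integrable_lipschitz_gauss(2)[OF v L, of _ _ 0, simplified]
  have "(\<integral>y. exp (l * f y) \<partial>gauss v) \<le> exp (\<bar>l\<bar> * L\<^sup>2 * \<eta> + I)" if eta: "\<eta> > 0" for \<eta>
  proof -
    define \<delta> where "\<delta> = L\<^sup>2 * \<eta> / 2"
    obtain g where g: "lipschitz_convex L g" "second_difference_le (1 / \<eta>) g"
      and gf: "\<And>x. g x \<le> f x" and fg: "\<And>x. f x \<le> g x + \<delta>"
      unfolding \<delta>_def using Moreau_envelope[OF f eta] by blast
    have l1: "l * a \<le> l * b + \<bar>l\<bar> * \<delta>" if "\<bar>a - b\<bar> \<le> \<delta>" for a b
    proof -
      have "l * (a - b) \<le> \<bar>l\<bar> * \<bar>a - b\<bar>" by (metis abs_ge_self abs_mult)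
      also have "\<dots> \<le> \<bar>l\<bar> * \<delta>" using that by (intro mult_left_mono) auto
      finally show ?thesis by (simp add: algebra_simps)
    qed
    have "(\<integral>y. exp (l * f y) \<partial>gauss v) \<le> (\<integral>y. exp (l * g y) * exp (\<bar>l\<bar> * \<delta>) \<partial>gauss v)"
    proof (rule integral_mono)
      show "exp (l * f y) \<le> exp (l * g y) * exp (\<bar>l\<bar> * \<delta>)" for y
        using l1[of "f y" "g y"] gf[of y] fg[of y] by (simp flip: exp_add)
    qed (intro inte f integrable_mult_left g)+
    also have "\<dots> = (\<integral>y. exp (l * g y) \<partial>gauss v) * exp (\<bar>l\<bar> * \<delta>)"
      by simp
    also have "\<dots> \<le> exp (l\<^sup>2 * L\<^sup>2 * v / 2 + l * (\<integral>y. g y \<partial>gauss v)) * exp (\<bar>l\<bar> * \<delta>)"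
      using eta by (intro mult_right_mono integral_exp_gauss_le_smooth[OF v L _ g]) auto
    also have "\<dots> \<le> exp (\<bar>l\<bar> * L\<^sup>2 * \<eta> + I)"
    proof -
      have "(\<integral>y. g y \<partial>gauss v) \<le> (\<integral>y. f y \<partial>gauss v)"
        by (intro integral_mono int[OF f] int[OF g(1)] gf)
      moreover have "(\<integral>y. f y \<partial>gauss v) \<le> (\<integral>y. g y + \<delta> \<partial>gauss v)"
        by (intro integral_mono Bochner_Integration.integrable_add int[OF f] int[OF g(1)] fg) simp
      ultimately have "l * (\<integral>y. g y \<partial>gauss v) \<le> l * (\<integral>y. f y \<partial>gauss v) + \<bar>l\<bar> * \<delta>"
        using int[OF g(1)] by (intro l1) (simp add: prob_space[simplified])
      then show ?thesis
        by (simp add: I_def \<delta>_def flip: exp_add)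
    qed
    finally show ?thesis .
  qed
  then have ev: "\<forall>\<^sub>F \<eta> in at_right 0. (\<integral>y. exp (l * f y) \<partial>gauss v) \<le> exp (\<bar>l\<bar> * L\<^sup>2 * \<eta> + I)"
    using eventually_at_right_less[of "0::real"] by (auto elim: eventually_mono)
  have "((\<lambda>\<eta>. exp (\<bar>l\<bar> * L\<^sup>2 * \<eta> + I)) \<longlongrightarrow> exp (\<bar>l\<bar> * L\<^sup>2 * 0 + I)) (at_right 0)"
    by (intro tendsto_intros)
  from tendsto_lowerbound[OF this ev]
  have "(\<integral>y. exp (l * f y) \<partial>gauss v) \<le> exp (\<bar>l\<bar> * L\<^sup>2 * 0 + I)"
    by simp
  then show ?thesis by (simp add: I_def)
qed

text \<open>Chernoff's bound. The exponential moment is controlled for \<open>l\<close> of either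
  sign, so \<open>c = -1\<close> gives the lower tail although \<open>- f\<close> need not be
  convex. Strictness of \<open>L > 0\<close> matters: for \<open>L = 0\<close> the function is
  constant and the event has probability one.\<close>

lemma (in prob_space) gauss_concentration:
  fixes f :: "'b::euclidean_space \<Rightarrow> real"
  assumes v: "v > 0" and L: "L > 0" and f: "lipschitz_convex L f"
    and X [measurable]: "X \<in> borel_measurable M" and law: "distr M borel X = gauss v"
    and p: "0 < p" "p < 1" and c: "\<bar>c\<bar> = 1"
  shows "prob {\<omega> \<in> space M. c * (f (X \<omega>) - (\<integral>\<omega>. f (X \<omega>) \<partial>M)) \<ge> L * sqrt (2 * v * ln (1 / p))} \<le> p"
proof -
  define t where "t = L * sqrt (2 * v * ln (1 / p))"
  define E where "E = (\<integral>\<omega>. f (X \<omega>) \<partial>M)"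
  \<comment> \<open>This \<open>s\<close> minimizes
    \<open>- s * t + s\<^sup>2 * L\<^sup>2 * v / 2\<close>; the minimum
    \<open>- t\<^sup>2 / (2 * v * L\<^sup>2)\<close> equals \<open>ln p\<close> by the choice of
    \<open>t\<close>.\<close>
  define s where "s = t / (v * L\<^sup>2)"
  have lnp: "ln (1 / p) > 0" using p by simp
  have t: "t > 0" and t2: "t\<^sup>2 = 2 * v * L\<^sup>2 * ln (1 / p)"
    using v L lnp by (auto simp: t_def power_mult_distrib)
  have s: "s > 0" using t v L by (simp add: s_def)
  have c2: "c\<^sup>2 = 1" using c by (metis power2_abs one_power2)
  note [measurable] = lipschitz_convex_measurable[OF f]
  note inte = integrable_lipschitz_gauss(2)[OF v less_imp_le[OF L] f, of "s * c" 0, simplified]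
  have E: "E = (\<integral>y. f y \<partial>gauss v)"
    unfolding E_def by (subst law[symmetric]) (simp add: integral_distr)
  have i: "integrable M (\<lambda>\<omega>. exp (s * (c * (f (X \<omega>) - E))))"
  proof -
    have "integrable M (\<lambda>\<omega>. exp (s * c * f (X \<omega>)))"
      using inte unfolding law[symmetric] by (simp add: integrable_distr_eq)
    then have "integrable M (\<lambda>\<omega>. exp (s * c * f (X \<omega>)) * exp (- (s * c * E)))"
      by (rule integrable_mult_left)
    then show ?thesis
      by (simp add: algebra_simps flip: exp_add)
  qed
  have "(\<integral>\<omega>. exp (s * (c * (f (X \<omega>) - E))) \<partial>M) = (\<integral>\<omega>. exp (s * c * f (X \<omega>)) * exp (- (s * c * E)) \<partial>M)"
    by (simp add: algebra_simps flip: exp_add)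
  also have "\<dots> = (\<integral>y. exp (s * c * f y) \<partial>gauss v) * exp (- (s * c * E))"
    by (subst law[symmetric]) (simp add: integral_distr)
  also have "\<dots> \<le> exp ((s * c)\<^sup>2 * L\<^sup>2 * v / 2 + s * c * E) * exp (- (s * c * E))"
    unfolding E by (intro mult_right_mono integral_exp_gauss_le[OF v less_imp_le[OF L] f]) simp
  also have "\<dots> = exp (s\<^sup>2 * L\<^sup>2 * v / 2)"
    by (simp add: power_mult_distrib c2 flip: exp_add)
  finally have mgf: "(\<integral>\<omega>. exp (s * (c * (f (X \<omega>) - E))) \<partial>M) \<le> exp (s\<^sup>2 * L\<^sup>2 * v / 2)" .
  have "prob {\<omega> \<in> space M. c * (f (X \<omega>) - E) \<ge> t} \<le>
      exp (- s * t) * (\<integral>\<omega>\<in>space M. exp (s * (c * (f (X \<omega>) - E))) \<partial>M)"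
    using integrable_mult_indicator[OF sets.top i] by (intro Chernoff_ineq_ge s) (auto simp: set_integrable_def)
  also have "\<dots> \<le> exp (- s * t) * exp (s\<^sup>2 * L\<^sup>2 * v / 2)"
    using mgf i by (intro mult_left_mono) (simp_all add: set_integral_space)
  also have "\<dots> = exp (- s * t + s\<^sup>2 * L\<^sup>2 * v / 2)"
    by (rule exp_add[symmetric])
  also have "- s * t + s\<^sup>2 * L\<^sup>2 * v / 2 = - t\<^sup>2 / (2 * v * L\<^sup>2)"
    using v L by (simp add: s_def power2_eq_square field_simps)
  also have "\<dots> = ln p"
    using v L p by (simp add: t2 ln_div)
  finally show ?thesis
    using p by (simp add: t_def E_def)
qed

section \<open>The score norm\<close>

lemma convex_on_powr_nonneg:
  assumes "p \<ge> 1"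
  shows "convex_on {0..} (\<lambda>x::real. x powr p)"
proof (rule convex_onI)
  fix t x y :: real
  assume t: "0 < t" "t < 1" and "x \<in> {0..}" "y \<in> {0..}"
  then have xy: "x \<ge> 0" "y \<ge> 0" by auto
  \<comment> \<open>Handles the boundary point 0: when one argument is zero, convexity reduces to
    \<open>u powr p \<le> u\<close> for \<open>u\<close> between 0 and 1.\<close>
  have small: "(u * z) powr p \<le> u * z powr p" if "0 < u" "u < 1" "z \<ge> 0" for u z :: real
  proof -
    have "u powr p \<le> u powr 1" using that assms by (intro powr_mono') auto
    then show ?thesis using that by (simp add: powr_mult mult_right_mono)
  qed
  consider "x = 0" | "y = 0" | "x > 0" "y > 0" using xy by fastforce
  then show "((1 - t) *\<^sub>R x + t *\<^sub>R y) powr p \<le> (1 - t) * x powr p + t * y powr p"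
  proof cases
    case 3
    then show ?thesis using convex_onD[OF powr_convex[OF assms], of t x y] t by simp
  qed (use small[of t y] small[of "1 - t" x] t xy in auto)
qed simp

context
  fixes p :: real
  assumes p: "p \<ge> 1"
begin

lemma lq_norm_ereal: "lq_norm (ereal p) x = (\<Sum>j\<in>UNIV. \<bar>x $ j\<bar> powr p) powr (1 / p)"
  by (simp add: lq_norm_def)

lemma lq_norm_powr: "lq_norm (ereal p) x powr p = (\<Sum>j\<in>UNIV. \<bar>x $ j\<bar> powr p)"
  using p by (simp add: lq_norm_ereal powr_powr sum_nonneg)

lemma lq_norm_ereal_le_iff:
  assumes "c \<ge> 0"
  shows "lq_norm (ereal p) x \<le> c \<longleftrightarrow> (\<Sum>j\<in>UNIV. \<bar>x $ j\<bar> powr p) \<le> c powr p"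
proof
  assume "lq_norm (ereal p) x \<le> c"
  then show "(\<Sum>j\<in>UNIV. \<bar>x $ j\<bar> powr p) \<le> c powr p"
    unfolding lq_norm_powr[symmetric] using p by (intro powr_mono2) (auto simp: lq_norm_ereal)
next
  assume "(\<Sum>j\<in>UNIV. \<bar>x $ j\<bar> powr p) \<le> c powr p"
  then have "lq_norm (ereal p) x \<le> (c powr p) powr (1 / p)"
    unfolding lq_norm_ereal using p by (intro powr_mono2) (auto intro: sum_nonneg)
  then show "lq_norm (ereal p) x \<le> c"
    using p assms by (simp add: powr_powr)
qed

lemma lq_norm_ereal_eq_0_iff: "lq_norm (ereal p) x = 0 \<longleftrightarrow> x = 0"
  by (auto simp: lq_norm_ereal sum_nonneg_eq_0_iff vec_eq_iff)

text \<open>Minkowski's inequality by normalization: \<open>x / a\<close> and \<open>y / b\<close>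
  have norm 1, and \<open>(x + y) / (a + b)\<close> is their convex combination with weights
  \<open>a / (a + b)\<close> and \<open>b / (a + b)\<close>. Convexity of the power is applied in
  each coordinate. Zero vectors are treated apart because \<open>a\<close> and \<open>b\<close> are
  divisors.\<close>

lemma lq_norm_ereal_triangle: "lq_norm (ereal p) (x + y) \<le> lq_norm (ereal p) x + lq_norm (ereal p) y"
proof (cases "x = 0 \<or> y = 0")
  case True
  then show ?thesis by (auto simp: lq_norm_ereal)
next
  case False
  define a b where "a = lq_norm (ereal p) x" and "b = lq_norm (ereal p) y"
  have "a \<ge> 0" "b \<ge> 0" by (simp_all add: a_def b_def lq_norm_ereal)
  moreover have "a \<noteq> 0" "b \<noteq> 0"
    using False by (simp_all add: a_def b_def lq_norm_ereal_eq_0_iff)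
  ultimately have ab: "a > 0" "b > 0" by simp_all
  define t where "t = b / (a + b)"
  have t: "0 \<le> t" "t \<le> 1" "1 - t = a / (a + b)"
    using ab by (auto simp: t_def field_simps)
  have "(\<Sum>j\<in>UNIV. \<bar>(x + y) $ j\<bar> powr p) \<le>
      (\<Sum>j\<in>UNIV. (a + b) powr p * ((1 - t) * (\<bar>x $ j\<bar> / a) powr p + t * (\<bar>y $ j\<bar> / b) powr p))"
  proof (rule sum_mono)
    fix j
    have "\<bar>(x + y) $ j\<bar> powr p \<le> (\<bar>x $ j\<bar> + \<bar>y $ j\<bar>) powr p"
      using p by (intro powr_mono2) auto
    also have "\<bar>x $ j\<bar> + \<bar>y $ j\<bar> = (a + b) * ((1 - t) *\<^sub>R (\<bar>x $ j\<bar> / a) + t *\<^sub>R (\<bar>y $ j\<bar> / b))"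
      using ab unfolding t(3) by (simp add: t_def distrib_left)
    also have "\<dots> powr p = (a + b) powr p * ((1 - t) *\<^sub>R (\<bar>x $ j\<bar> / a) + t *\<^sub>R (\<bar>y $ j\<bar> / b)) powr p"
      by (rule powr_mult)
    also have "\<dots> \<le> (a + b) powr p * ((1 - t) * (\<bar>x $ j\<bar> / a) powr p + t * (\<bar>y $ j\<bar> / b) powr p)"
      using ab t by (intro mult_left_mono convex_onD[OF convex_on_powr_nonneg[OF p]]) auto
    finally show "\<bar>(x + y) $ j\<bar> powr p \<le>
      (a + b) powr p * ((1 - t) * (\<bar>x $ j\<bar> / a) powr p + t * (\<bar>y $ j\<bar> / b) powr p)" .
  qed
  also have "\<dots> = (a + b) powr p * ((1 - t) * ((\<Sum>j\<in>UNIV. \<bar>x $ j\<bar> powr p) / a powr p)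
       + t * ((\<Sum>j\<in>UNIV. \<bar>y $ j\<bar> powr p) / b powr p))"
    using ab by (simp add: powr_divide sum.distrib sum_distrib_left sum_divide_distrib distrib_left)
  also have "\<dots> = (a + b) powr p"
    using ab unfolding lq_norm_powr[symmetric] a_def[symmetric] b_def[symmetric] by simp
  finally show ?thesis
    using ab unfolding a_def[symmetric] b_def[symmetric] by (simp add: lq_norm_ereal_le_iff)
qed

lemma lq_norm_ereal_mono:
  assumes "\<And>j. \<bar>x $ j\<bar> \<le> \<bar>y $ j\<bar>"
  shows "lq_norm (ereal p) x \<le> lq_norm (ereal p) y"
  unfolding lq_norm_ereal using p assms by (intro powr_mono2 sum_mono) (auto intro: sum_nonneg)

lemma lq_norm_ereal_scaleR: "lq_norm (ereal p) (c *\<^sub>R x) = \<bar>c\<bar> * lq_norm (ereal p) x"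
  using p by (simp add: lq_norm_ereal abs_mult powr_mult sum_nonneg powr_powr flip: sum_distrib_left)

end

section \<open>The l_q-norm for all exponents, including infinity\<close>

lemma lq_norm_infinity_le_iff: "lq_norm \<infinity> x \<le> c \<longleftrightarrow> (\<forall>j. \<bar>x $ j\<bar> \<le> c)"
  by (auto simp: lq_norm_def)

lemma abs_le_lq_norm_infinity: "\<bar>x $ j\<bar> \<le> lq_norm \<infinity> x"
  using lq_norm_infinity_le_iff[of x "lq_norm \<infinity> x"] by simp

lemma ereal_ge_1_cases:
  assumes "1 \<le> (q :: ereal)"
  obtains "q = \<infinity>" | p where "q = ereal p" "p \<ge> 1"
  using assms by (cases q) auto

lemma lq_norm_triangle:
  assumes "1 \<le> q"
  shows "lq_norm q (x + y) \<le> lq_norm q x + lq_norm q y"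
  using assms
proof (cases q rule: ereal_ge_1_cases)
  case 1
  show ?thesis
    unfolding 1 lq_norm_infinity_le_iff
    using abs_le_lq_norm_infinity[of x] abs_le_lq_norm_infinity[of y]
    by (auto intro: order_trans[OF abs_triangle_ineq] add_mono)
qed (simp_all add: lq_norm_ereal_triangle)

lemma lq_norm_mono:
  assumes "1 \<le> q" and "\<And>j. \<bar>x $ j\<bar> \<le> \<bar>y $ j\<bar>"
  shows "lq_norm q x \<le> lq_norm q y"
  using assms(1)
proof (cases q rule: ereal_ge_1_cases)
  case 1
  show ?thesis
    unfolding 1 lq_norm_infinity_le_iff
    using assms(2) abs_le_lq_norm_infinity[of y] order_trans by blast
qed (simp_all add: lq_norm_ereal_mono assms)

lemma lq_norm_scaleR:
  assumes "1 \<le> q"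
  shows "lq_norm q (c *\<^sub>R x) = \<bar>c\<bar> * lq_norm q x"
  using assms
proof (cases q rule: ereal_ge_1_cases)
  case 1
  have m: "mono (\<lambda>t. \<bar>c\<bar> * t)"
    by (intro monoI mult_left_mono) auto
  have "range (\<lambda>j. \<bar>c * x $ j\<bar>) = (\<lambda>t. \<bar>c\<bar> * t) ` range (\<lambda>j. \<bar>x $ j\<bar>)"
    by (auto simp: abs_mult)
  then show ?thesis
    by (simp add: 1 lq_norm_def mono_Max_commute[OF m])
qed (simp_all add: lq_norm_ereal_scaleR)

lemma lq_norm_nonneg: "0 \<le> lq_norm q x"
  by (cases "q = \<infinity>") (auto simp: lq_norm_def Max_ge_iff intro!: powr_ge_zero)

lemma lq_norm_eq_0_iff:
  assumes "1 \<le> q"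
  shows "lq_norm q x = 0 \<longleftrightarrow> x = 0"
  using assms
proof (cases q rule: ereal_ge_1_cases)
  case 1
  show ?thesis
    using abs_le_lq_norm_infinity[of x] lq_norm_infinity_le_iff[of x 0] lq_norm_nonneg[of q x]
    by (auto simp: 1 vec_eq_iff intro: antisym)
qed (simp_all add: lq_norm_ereal_eq_0_iff)

lemma lq_norm_minus: "lq_norm q (- x) = lq_norm q x"
  by (simp add: lq_norm_def)

section \<open>The score norm and its simulated average as Lipschitz functions\<close>

lemma score_norm_triangle: "1 \<le> q \<Longrightarrow> score_norm q X (x + y) \<le> score_norm q X x + score_norm q X y"
  by (simp add: score_norm_def matrix_vector_right_distrib scaleR_add_right lq_norm_triangle)

lemma score_norm_scaleR: "1 \<le> q \<Longrightarrow> score_norm q X (c *\<^sub>R x) = \<bar>c\<bar> * score_norm q X x"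
  by (simp add: score_norm_def matrix_vector_mult_scaleR lq_norm_scaleR)

text \<open>A Lipschitz constant of \<open>score_norm q X\<close> for the Euclidean norm. By
  \<open>tau_eq\<close>, \<open>tau\<close> is the threshold of \<open>gauss_concentration\<close>
  for this constant and variance \<open>\<sigma>\<^sup>2\<close>.\<close>

definition score_lipschitz :: "ereal \<Rightarrow> real^'l^'n \<Rightarrow> real" where
  "score_lipschitz q X = lq_norm q (col_rms X) / sqrt (real CARD('n))"

text \<open>Each coordinate of \<open>transpose X *v w\<close> is the inner product of a column of
  \<open>X\<close> with \<open>w\<close>. Cauchy-Schwarz bounds it, and the norm of column
  \<open>j\<close> is \<open>sqrt n\<close> times \<open>col_rms X $ j\<close>; dividing by
  \<open>n\<close> leaves \<open>1 / sqrt n\<close>.\<close>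

lemma score_norm_le:
  fixes X :: "real^'l^'n"
  assumes "1 \<le> q"
  shows "score_norm q X w \<le> score_lipschitz q X * norm w"
proof -
  let ?n = "real CARD('n)"
  have "score_norm q X w \<le> lq_norm q ((norm w / sqrt ?n) *\<^sub>R col_rms X)"
    unfolding score_norm_def
  proof (rule lq_norm_mono[OF assms])
    fix j
    have "\<bar>(transpose X *v w) $ j\<bar> = \<bar>column j X \<bullet> w\<bar>"
      by (simp add: matrix_vector_mult_def transpose_def column_def inner_vec_def)
    also have "\<dots> \<le> norm (column j X) * norm w"
      by (rule Cauchy_Schwarz_ineq2)
    also have "norm (column j X) = sqrt ?n * col_rms X $ j"
      by (simp add: col_rms_def norm_vec_def L2_set_def column_def real_sqrt_mult real_sqrt_divide)
    finally have "1 / ?n * \<bar>(transpose X *v w) $ j\<bar> \<le> 1 / ?n * (sqrt ?n * col_rms X $ j * norm w)"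
      by (intro mult_left_mono) auto
    also have "\<dots> = norm w / sqrt ?n * col_rms X $ j"
      by (simp add: field_simps)
    finally show "\<bar>((1 / ?n) *\<^sub>R (transpose X *v w)) $ j\<bar> \<le> \<bar>((norm w / sqrt ?n) *\<^sub>R col_rms X) $ j\<bar>"
      by (auto simp: abs_mult intro: order_trans[OF _ divide_right_mono[OF mult_left_mono[OF abs_ge_self]]])
  qed
  then show ?thesis
    by (simp add: lq_norm_scaleR[OF assms] score_lipschitz_def mult.commute)
qed

lemma score_norm_diff:
  assumes "1 \<le> q"
  shows "\<bar>score_norm q X x - score_norm q X y\<bar> \<le> score_lipschitz q X * norm (x - y)"
  using score_norm_triangle[OF assms, of X "x - y" y] score_norm_triangle[OF assms, of X "y - x" x]
    score_norm_le[OF assms, of X "x - y"] score_norm_le[OF assms, of X "y - x"]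
  by (simp add: norm_minus_commute abs_le_iff)

lemma score_norm_convex:
  fixes X :: "real^'l^'n"
  assumes "1 \<le> q"
  shows "convex_on UNIV (score_norm q X)"
proof (rule convex_onI)
  fix t :: real and x y :: "real^'n" assume "0 < t" "t < 1"
  then show "score_norm q X ((1 - t) *\<^sub>R x + t *\<^sub>R y) \<le> (1 - t) * score_norm q X x + t * score_norm q X y"
    using score_norm_triangle[OF assms, of X "(1 - t) *\<^sub>R x" "t *\<^sub>R y"] by (simp add: score_norm_scaleR assms)
qed simp

lemma lipschitz_convex_score_norm:
  "1 \<le> q \<Longrightarrow> lipschitz_convex (score_lipschitz q X) (score_norm q X)"
  by (simp add: lipschitz_convex_def score_norm_convex score_norm_diff)

text \<open>A nonzero entry gives its column a positive root mean square. The strict sign is what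
  \<open>gauss_concentration\<close> asks for.\<close>

lemma score_lipschitz_pos:
  fixes X :: "real^'l^'n"
  assumes "1 \<le> q" "X \<noteq> 0"
  shows "score_lipschitz q X > 0"
proof -
  obtain i j where "X $ i $ j \<noteq> 0"
    using \<open>X \<noteq> 0\<close> by (auto simp: vec_eq_iff)
  then have "(\<Sum>i\<in>UNIV. (X $ i $ j)\<^sup>2) > 0"
    by (intro sum_pos2[of _ i]) auto
  then have "col_rms X $ j \<noteq> 0"
    by (simp add: col_rms_def)
  then have "lq_norm q (col_rms X) \<noteq> 0"
    unfolding lq_norm_eq_0_iff[OF assms(1)] by (metis zero_index)
  then show ?thesis
    using lq_norm_nonneg[of q "col_rms X"] by (simp add: score_lipschitz_def)
qed

lemma tau_eq: "\<sigma> > 0 \<Longrightarrow> tau \<sigma> q X s = score_lipschitz q X * sqrt (2 * \<sigma>\<^sup>2 * ln (1 / s))"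
  by (simp add: tau_def score_lipschitz_def real_sqrt_mult real_sqrt_divide)

text \<open>Viewing the average as one function of the whole matrix allows a single application of
  Gaussian concentration on the matrix space.\<close>

definition mean_score :: "ereal \<Rightarrow> real^'l^'n \<Rightarrow> real^'r^'n \<Rightarrow> real" where
  "mean_score q X Z = (\<Sum>r\<in>UNIV. score_norm q X (column r Z)) / real CARD('r)"

text \<open>Cauchy-Schwarz against the constant 1, since the Frobenius norm is the Euclidean norm of
  the vector of column norms. This is the source of the factor \<open>1 / sqrt R\<close> in the
  Lipschitz constant of the average.\<close>

lemma sum_norm_column_le:
  fixes Z :: "real^'r^'n"
  shows "(\<Sum>r\<in>UNIV. norm (column r Z)) \<le> sqrt (real CARD('r)) * norm Z"
proof -
  have "(\<Sum>r\<in>UNIV. \<bar>1\<bar> * \<bar>norm (column r Z)\<bar>) \<le> L2_set (\<lambda>_::'r. 1) UNIV * L2_set (\<lambda>r. norm (column r Z)) UNIV"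
    by (rule L2_set_mult_ineq)
  moreover have "L2_set (\<lambda>r. norm (column r Z)) UNIV = norm Z"
  proof -
    have "(\<Sum>r\<in>UNIV. (norm (column r Z))\<^sup>2) = (\<Sum>r\<in>UNIV. \<Sum>i\<in>UNIV. (Z $ i $ r)\<^sup>2)"
      by (simp add: norm_vec_def L2_set_def column_def sum_nonneg)
    also have "\<dots> = (\<Sum>i\<in>UNIV. \<Sum>r\<in>UNIV. (Z $ i $ r)\<^sup>2)"
      by (rule sum.swap)
    also have "\<dots> = (\<Sum>i\<in>UNIV. (norm (Z $ i))\<^sup>2)"
      by (simp add: norm_vec_def[of "Z $ i" for i] L2_set_def sum_nonneg)
    finally show ?thesis
      by (simp add: norm_vec_def[of Z] L2_set_def)
  qed
  ultimately show ?thesis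
    by (simp add: L2_set_def)
qed

lemma lipschitz_convex_mean_score:
  fixes X :: "real^'l^'n"
  assumes "1 \<le> q"
  shows "lipschitz_convex (score_lipschitz q X / sqrt (real CARD('r))) (mean_score q X :: real^'r^'n \<Rightarrow> real)"
  unfolding lipschitz_convex_def
proof (intro conjI allI convex_onI)
  let ?L = "score_lipschitz q X" and ?R = "real CARD('r)"
  fix Z Z' :: "real^'r^'n"
  have L0: "?L \<ge> 0" by (simp add: score_lipschitz_def lq_norm_nonneg)
  have "\<bar>\<Sum>r\<in>UNIV. score_norm q X (column r Z) - score_norm q X (column r Z')\<bar>
      \<le> (\<Sum>r\<in>UNIV. ?L * norm (column r (Z - Z')))"
  proof (rule order_trans[OF sum_abs sum_mono])
    fix r
    have "column r (Z - Z') = column r Z - column r Z'"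
      by (simp add: column_def vec_eq_iff)
    then show "\<bar>score_norm q X (column r Z) - score_norm q X (column r Z')\<bar> \<le> ?L * norm (column r (Z - Z'))"
      using score_norm_diff[OF assms, of X "column r Z" "column r Z'"] by simp
  qed
  also have "\<dots> \<le> ?L * (sqrt ?R * norm (Z - Z'))"
    unfolding sum_distrib_left[symmetric] by (intro mult_left_mono sum_norm_column_le L0)
  finally have "\<bar>\<Sum>r\<in>UNIV. score_norm q X (column r Z) - score_norm q X (column r Z')\<bar> / ?R
      \<le> ?L * (sqrt ?R * norm (Z - Z')) / ?R"
    by (rule divide_right_mono) simp
  also have "\<dots> = ?L / sqrt ?R * norm (Z - Z')"
    by (simp add: field_simps)
  finally show "\<bar>mean_score q X Z - mean_score q X Z'\<bar> \<le> ?L / sqrt ?R * norm (Z - Z')"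
    by (simp add: mean_score_def sum_subtractf flip: diff_divide_distrib)
next
  fix t :: real and Z Z' :: "real^'r^'n" assume t: "0 < t" "t < 1"
  have "score_norm q X (column r ((1 - t) *\<^sub>R Z + t *\<^sub>R Z')) \<le>
     (1 - t) * score_norm q X (column r Z) + t * score_norm q X (column r Z')" for r
  proof -
    have "column r ((1 - t) *\<^sub>R Z + t *\<^sub>R Z') = (1 - t) *\<^sub>R column r Z + t *\<^sub>R column r Z'"
      by (simp add: column_def vec_eq_iff)
    then show ?thesis
      using convex_onD[OF score_norm_convex[OF assms], of t "column r Z" "column r Z'" X] t by simp
  qed
  then have "(\<Sum>r\<in>UNIV. score_norm q X (column r ((1 - t) *\<^sub>R Z + t *\<^sub>R Z'))) \<le>
     (\<Sum>r\<in>UNIV. (1 - t) * score_norm q X (column r Z) + t * score_norm q X (column r Z'))"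
    by (rule sum_mono)
  also have "\<dots> = (1 - t) * (\<Sum>r\<in>UNIV. score_norm q X (column r Z)) + t * (\<Sum>r\<in>UNIV. score_norm q X (column r Z'))"
    by (simp only: sum.distrib sum_distrib_left)
  finally have "(\<Sum>r\<in>UNIV. score_norm q X (column r ((1 - t) *\<^sub>R Z + t *\<^sub>R Z'))) / real CARD('r) \<le>
     ((1 - t) * (\<Sum>r\<in>UNIV. score_norm q X (column r Z)) + t * (\<Sum>r\<in>UNIV. score_norm q X (column r Z'))) / real CARD('r)"
    by (rule divide_right_mono) simp
  then show "mean_score q X ((1 - t) *\<^sub>R Z + t *\<^sub>R Z') \<le> (1 - t) * mean_score q X Z + t * mean_score q X Z'"
    unfolding mean_score_def times_divide_eq_right add_divide_distrib[symmetric] .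
qed simp

section \<open>Type I and type II errors\<close>

text \<open>\<iota> names the normal variable behind each coordinate of \<open>S\<close>. Its
  generality serves both the full simulated matrix and a single column;
  \<open>indep_vars_reindex\<close> moves independence from entries to basis vectors.\<close>

lemma (in prob_space) scaled_normal_coordinates:
  fixes S :: "'a \<Rightarrow> 'b::euclidean_space" and \<xi> :: "'i \<Rightarrow> 'a \<Rightarrow> real"
  assumes indep: "indep_vars (\<lambda>_. borel) \<xi> UNIV"
    and law: "\<And>k. distributed M lborel (\<xi> k) (\<lambda>z. ennreal (normal_density 0 1 z))"
    and \<sigma>: "\<sigma> > 0"
    and \<iota>: "inj_on \<iota> Basis" "\<And>b \<omega>. b \<in> Basis \<Longrightarrow> S \<omega> \<bullet> b = \<sigma> * \<xi> (\<iota> b) \<omega>"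
  shows "S \<in> borel_measurable M" and "distr M borel S = gauss (\<sigma>\<^sup>2)"
proof -
  have [measurable]: "\<xi> k \<in> borel_measurable M" for k
    using distributed_measurable[OF law[of k]] by simp
  show "S \<in> borel_measurable M"
    by (subst borel_measurable_euclidean_space) (simp add: \<iota>(2))
  show "distr M borel S = gauss (\<sigma>\<^sup>2)"
  proof (rule distr_eq_gauss)
    show "distributed M lborel (\<lambda>\<omega>. S \<omega> \<bullet> b) (normal_density 0 (sqrt (\<sigma>\<^sup>2)))" if "b \<in> Basis" for b
      using normal_density_affine[OF law[of "\<iota> b"], of \<sigma> 0] \<sigma> \<iota>(2)[OF that] by simp
    have "indep_vars (\<lambda>_. borel) (\<lambda>k \<omega>. \<sigma> * \<xi> k \<omega>) (\<iota> ` Basis)"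
      using indep_vars_compose2[OF indep, of "\<lambda>_ x. \<sigma> * x" "\<lambda>_. borel"]
      by (rule indep_vars_subset) auto
    from indep_vars_reindex[OF \<iota>(1) this]
    show "indep_vars (\<lambda>_. borel) (\<lambda>b \<omega>. S \<omega> \<bullet> b) Basis"
      by (subst indep_vars_cong[OF refl, where Y = "\<lambda>b \<omega>. \<sigma> * \<xi> (\<iota> b) \<omega>" and N' = "\<lambda>_. borel"])
         (auto simp: \<iota>(2))
  qed (use \<sigma> in simp)
qed

lemma distr_iso_normal:
  fixes W :: "'a \<Rightarrow> real^'n"
  assumes W: "distributed M lborel W (\<lambda>w. ennreal (iso_normal_density \<sigma> w))" and \<sigma>: "\<sigma> > 0"
  shows "W \<in> borel_measurable M" and "distr M borel W = gauss (\<sigma>\<^sup>2)"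
proof -
  show "W \<in> borel_measurable M"
    using distributed_measurable[OF W] by simp
  have "distr M borel W = distr M lborel W"
    by (intro distr_cong) auto
  also have "\<dots> = gauss (\<sigma>\<^sup>2)"
    by (simp add: distributed_distr_eq_density[OF W] gauss_def gauss_density_def iso_normal_density_def)
  finally show "distr M borel W = gauss (\<sigma>\<^sup>2)" .
qed

text \<open>Homogeneity moves \<sigma> inside the simulated matrix, so that its columns have the
  variance of the noise.\<close>

lemma crit_r_eq:
  fixes Z :: "real^'r^'n"
  assumes "1 \<le> q" "\<sigma> > 0"
  shows "crit_r \<sigma> q X Z a b =
    mean_score q X (\<sigma> *\<^sub>R Z) + tau \<sigma> q X a + sqrt (1 / real CARD('r)) * tau \<sigma> q X b"
proof -
  have "column r (\<sigma> *\<^sub>R Z) = \<sigma> *\<^sub>R column r Z" for r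
    by (simp add: column_def vec_eq_iff)
  then show ?thesis
    using assms by (simp add: crit_r_def mean_score_def score_norm_scaleR flip: sum_distrib_left)
qed

lemma transpose_mult_vec:
  fixes X :: "real^'l^'n"
  shows "transpose X *v w = (\<Sum>i\<in>UNIV. (w $ i) *\<^sub>R X $ i)"
  by (simp add: vec_eq_iff matrix_vector_mult_def transpose_def mult.commute)

text \<open>If \<open>\<Psi> \<theta>' \<le> r\<close>, then \<open>(\<theta>', 0)\<close> is
  feasible, which forces \<open>\<mu> = 0\<close> at every optimum; the constraint then gives
  \<open>\<Psi> \<theta> \<le> r\<close>.\<close>

lemma optimal_solution_gt:
  assumes "optimal_solution \<Psi> r h \<Omega> \<theta> \<mu>" and "h \<theta>' \<in> \<Omega>" and "\<Psi> \<theta> > r"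
  shows "\<Psi> \<theta>' > r"
proof (rule ccontr)
  assume "\<not> \<Psi> \<theta>' > r"
  then have "\<not> 0 < \<mu>"
    using assms(1,2) unfolding optimal_solution_def is_arg_min_def by force
  then show False
    using assms(1,3) unfolding optimal_solution_def is_arg_min_def by force
qed

theorem theorem2p1:
  fixes M :: "'a measure"
    and W Y :: "'a \<Rightarrow> real^'n"
    and Z :: "'a \<Rightarrow> real^'r^'n"
    and V :: "real^'k^'n"
    and f :: "real^'k \<Rightarrow> real^'l"
    and X :: "real^'l^'n"
    and g :: "real^'k \<Rightarrow> real^'p \<Rightarrow> real"
    and h :: "real^'p \<Rightarrow> real^'m"
    and \<Omega> :: "(real^'m) set"
    and \<theta>star :: "real^'p"
    and \<theta>hat :: "'a \<Rightarrow> real^'p"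
    and \<mu>hat r\<^sub>\<alpha> :: "'a \<Rightarrow> real"
    and \<sigma> \<alpha> \<alpha>\<^sub>1 \<alpha>\<^sub>2 :: real
    and q :: ereal
  assumes "prob_space M"
    and "\<sigma> > 0"
    and W_law: "distributed M lborel W (\<lambda>w. ennreal (iso_normal_density \<sigma> w))"
    and Z_law: "\<And>i r. distributed M lborel (\<lambda>\<omega>. Z \<omega> $ i $ r) (\<lambda>z. ennreal (normal_density 0 1 z))"
    and Z_indep: "prob_space.indep_vars M (\<lambda>_. borel) (\<lambda>(i, r) \<omega>. Z \<omega> $ i $ r) UNIV"
    and W_Z_indep: "prob_space.indep_set M
      (sets (vimage_algebra (space M) W borel)) (sets (vimage_algebra (space M) Z borel))"
    and model: "\<And>\<omega> i. \<omega> \<in> space M \<Longrightarrow> Y \<omega> $ i = g (V $ i) \<theta>star + W \<omega> $ i"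
    and X_eq: "X = feature_matrix f V"
    and X_nonzero: "X \<noteq> 0"
    and "\<Omega> \<noteq> {}" "closed \<Omega>" "null_params h \<Omega> \<noteq> {}"
    and "1 \<le> q"
    and "\<alpha>\<^sub>1 > 0" "\<alpha>\<^sub>2 > 0" "\<alpha>\<^sub>1 + \<alpha>\<^sub>2 = \<alpha>" "\<alpha> < 1"
    and r_eq: "\<And>\<omega>. \<omega> \<in> space M \<Longrightarrow> r\<^sub>\<alpha> \<omega> = crit_r \<sigma> q X (Z \<omega>) \<alpha>\<^sub>1 \<alpha>\<^sub>2"
    and optimal: "\<And>\<omega>. \<omega> \<in> space M \<Longrightarrow>
      optimal_solution (Psi q g V X (Y \<omega>)) (r\<^sub>\<alpha> \<omega>) h \<Omega> (\<theta>hat \<omega>) (\<mu>hat \<omega>)"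
    and Psi_measurable: "(\<lambda>\<omega>. Psi q g V X (Y \<omega>) (\<theta>hat \<omega>)) \<in> borel_measurable M"
  shows
      "(h \<theta>star \<in> \<Omega> \<longrightarrow>
         measure M {\<omega> \<in> space M. Psi q g V X (Y \<omega>) (\<theta>hat \<omega>) > r\<^sub>\<alpha> \<omega>} \<le> \<alpha>
         \<and> ((AE \<omega> in M. no_avoidable_tie (Psi q g V X (Y \<omega>)) (r\<^sub>\<alpha> \<omega>) (null_params h \<Omega>) (\<theta>hat \<omega>)) \<longrightarrow>
            measure M {\<omega> \<in> space M. Psi q g V X (Y \<omega>) (\<theta>hat \<omega>) \<ge> r\<^sub>\<alpha> \<omega>} \<le> \<alpha>))
       \<and>
       (\<forall>\<beta> \<beta>\<^sub>1 \<beta>\<^sub>2. \<beta>\<^sub>1 > 0 \<longrightarrow> \<beta>\<^sub>2 > 0 \<longrightarrow> \<beta>\<^sub>1 + \<beta>\<^sub>2 = \<beta> \<longrightarrow> \<beta> < 1 \<longrightarrow>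
         h \<theta>star \<notin> \<Omega> \<longrightarrow>
         (INF \<theta>\<in>null_params h \<Omega>.
            lq_norm q ((1 / real CARD('n)) *\<^sub>R
              (\<Sum>i\<in>UNIV. (g (V $ i) \<theta>star - g (V $ i) \<theta>) *\<^sub>R X $ i)))
           \<ge> separation M W \<sigma> q X CARD('r) \<alpha>\<^sub>1 \<alpha>\<^sub>2 \<beta>\<^sub>1 \<beta>\<^sub>2 \<longrightarrow>
         measure M {\<omega> \<in> space M. Psi q g V X (Y \<omega>) (\<theta>hat \<omega>) \<le> r\<^sub>\<alpha> \<omega>} \<le> \<beta>)"

proof -
  interpret prob_space M by fact
  note \<sigma> = \<open>\<sigma> > 0\<close> and q = \<open>1 \<le> q\<close>
  let ?L = "score_lipschitz q X" and ?R = "real CARD('r)" and ?\<tau> = "tau \<sigma> q X"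
  define \<rho> where "\<rho> = sqrt (1 / ?R)"
  define S where "S = (\<lambda>\<omega>. score_norm q X (W \<omega>))"
  define U where "U = (\<lambda>\<omega>. \<sigma> *\<^sub>R Z \<omega>)"
  define m where "m = (\<lambda>\<omega>. mean_score q X (U \<omega>))"
  define E where "E = (\<integral>\<omega>. S \<omega> \<partial>M)"
  have L: "?L > 0" by (rule score_lipschitz_pos[OF q X_nonzero])
  have v: "\<sigma>\<^sup>2 > 0" using \<sigma> by simp
  note W [measurable] = distr_iso_normal(1)[OF W_law \<sigma>] and W_gauss = distr_iso_normal(2)[OF W_law \<sigma>]
  have Z_law': "distributed M lborel ((\<lambda>(i, r) \<omega>. Z \<omega> $ i $ r) k) (\<lambda>z. ennreal (normal_density 0 1 z))" for k
    using Z_law by (cases k) simp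
  \<comment> \<open>Enumerates the basis of the matrix space by entries, so that its inverse names
    the entry of \<open>Z\<close> behind each coordinate.\<close>
  define e :: "'n \<times> 'r \<Rightarrow> real^'r^'n" where "e = (\<lambda>(i, r). axis i (axis r 1))"
  have e: "range e = Basis"
    by (auto simp: e_def Basis_vec_def)
  have U: "U \<in> borel_measurable M" "distr M borel U = gauss (\<sigma>\<^sup>2)"
  proof -
    have inj: "inj_on (inv e) Basis"
      unfolding e[symmetric] by (rule inj_on_inv_into) simp
    have "U \<omega> \<bullet> b = \<sigma> * (case inv e b of (i, r) \<Rightarrow> \<lambda>\<omega>. Z \<omega> $ i $ r) \<omega>" if "b \<in> Basis" for b \<omega>
    proof -
      have "b = e (inv e b)"
        using that by (simp add: f_inv_into_f e)
      then have "b = (case inv e b of (i, r) \<Rightarrow> axis i (axis r 1))"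
        by (simp add: e_def)
      then show ?thesis
        by (cases "inv e b") (simp add: U_def inner_axis)
    qed
    from scaled_normal_coordinates[OF Z_indep Z_law' \<sigma> inj this]
    show "U \<in> borel_measurable M" "distr M borel U = gauss (\<sigma>\<^sup>2)" by simp_all
  qed
  note [measurable] = U(1)
  note [measurable] = lipschitz_convex_measurable[OF lipschitz_convex_score_norm[OF q]]
    lipschitz_convex_measurable[OF lipschitz_convex_mean_score[OF q]]
  \<comment> \<open>Every column of \<open>U\<close> has the law of \<open>W\<close>. Hence each
    simulated score norm has the mean of \<open>S\<close>, and so does their average
    \<open>m\<close>.\<close>
  have col: "(\<lambda>\<omega>. column r (U \<omega>)) \<in> borel_measurable M \<and> distr M borel (\<lambda>\<omega>. column r (U \<omega>)) = gauss (\<sigma>\<^sup>2)" for r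
  proof -
    have inj: "inj_on (\<lambda>b. (axis_index b, r)) (Basis :: (real^'n) set)"
      by (auto simp: inj_on_def Basis_vec_def axis_index_axis)
    have "column r (U \<omega>) \<bullet> b = \<sigma> * (case (axis_index b, r) of (i, r) \<Rightarrow> \<lambda>\<omega>. Z \<omega> $ i $ r) \<omega>" if "b \<in> Basis" for b \<omega>
      using that by (auto simp: Basis_vec_def axis_index_axis inner_axis column_def U_def)
    from scaled_normal_coordinates[OF Z_indep Z_law' \<sigma> inj this] show ?thesis by simp
  qed
  have Em: "(\<integral>\<omega>. m \<omega> \<partial>M) = E"
  proof -
    let ?g = "gauss (\<sigma>\<^sup>2) :: (real^'n) measure"
    have int: "integrable ?g (score_norm q X)"
      using integrable_lipschitz_gauss(1)[OF v less_imp_le[OF L] lipschitz_convex_score_norm[OF q], of 0] by simp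
    have "integrable M (\<lambda>\<omega>. score_norm q X (column r (U \<omega>)))
      \<and> (\<integral>\<omega>. score_norm q X (column r (U \<omega>)) \<partial>M) = (\<integral>y. score_norm q X y \<partial>?g)" for r
    proof -
      have [measurable]: "(\<lambda>\<omega>. column r (U \<omega>)) \<in> borel_measurable M"
        and law: "distr M borel (\<lambda>\<omega>. column r (U \<omega>)) = ?g"
        using col[of r] by simp_all
      show ?thesis
        using int unfolding law[symmetric] by (simp add: integral_distr integrable_distr_eq)
    qed
    then have "(\<integral>\<omega>. m \<omega> \<partial>M) = (\<integral>y. score_norm q X y \<partial>?g)"
      by (simp add: m_def mean_score_def)
    also have "\<dots> = E"
      unfolding W_gauss[symmetric] by (simp add: integral_distr E_def S_def)
    finally show ?thesis .
  qed
  have tail_S: "prob {\<omega> \<in> space M. S \<omega> - E \<ge> ?\<tau> p} \<le> p" if "0 < p" "p < 1" for p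
    using gauss_concentration[OF v L lipschitz_convex_score_norm[OF q] W W_gauss that, of 1] \<sigma>
    by (simp add: S_def E_def tau_eq)
  \<comment> \<open>The Lipschitz constant is smaller by \<open>sqrt R\<close>, which is the factor
    \<rho> in the threshold. Both signs of \<open>c\<close> are kept: the type I error involves a
    low average, the type II error a high one.\<close>
  have tail_m: "prob {\<omega> \<in> space M. c * (m \<omega> - E) \<ge> \<rho> * ?\<tau> p} \<le> p" if "0 < p" "p < 1" "\<bar>c\<bar> = 1" for p c
  proof -
    have L': "?L / sqrt ?R > 0" using L by simp
    have "\<rho> * ?\<tau> p = ?L / sqrt ?R * sqrt (2 * \<sigma>\<^sup>2 * ln (1 / p))"
      using \<sigma> by (simp add: \<rho>_def tau_eq real_sqrt_divide)
    then show ?thesis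
      using gauss_concentration[OF v L' lipschitz_convex_mean_score[OF q, of X] U that]
      unfolding Em[unfolded m_def] by (simp add: m_def)
  qed
  have [measurable]: "S \<in> borel_measurable M" "m \<in> borel_measurable M"
    unfolding S_def m_def by measurable
  have union: "prob {\<omega> \<in> space M. S \<omega> - E \<ge> ?\<tau> p \<or> c * (m \<omega> - E) \<ge> \<rho> * ?\<tau> p'} \<le> p + p'"
    if "0 < p" "p < 1" "0 < p'" "p' < 1" "\<bar>c\<bar> = 1" for p p' c
  proof -
    have "{\<omega> \<in> space M. S \<omega> - E \<ge> ?\<tau> p \<or> c * (m \<omega> - E) \<ge> \<rho> * ?\<tau> p'} =
      {\<omega> \<in> space M. S \<omega> - E \<ge> ?\<tau> p} \<union> {\<omega> \<in> space M. c * (m \<omega> - E) \<ge> \<rho> * ?\<tau> p'}"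
      by auto
    also have "prob \<dots> \<le> p + p'"
      using tail_S[of p] tail_m[of p' c] that
      by (intro order_trans[OF measure_Un_le] add_mono) auto
    finally show ?thesis .
  qed
  have r: "r\<^sub>\<alpha> \<omega> = m \<omega> + ?\<tau> \<alpha>\<^sub>1 + \<rho> * ?\<tau> \<alpha>\<^sub>2" if "\<omega> \<in> space M" for \<omega>
    using that by (simp add: r_eq crit_r_eq[OF q \<sigma>] m_def U_def \<rho>_def)
  have Psi_star: "Psi q g V X (Y \<omega>) \<theta>star = S \<omega>" if "\<omega> \<in> space M" for \<omega>
    unfolding Psi_def S_def score_norm_def transpose_mult_vec using model[OF that] by simp
  \<comment> \<open>If \<open>S \<omega> \<ge> r\<^sub>\<alpha> \<omega>\<close>, then
    \<open>S \<omega> - E\<close> and \<open>E - m \<omega>\<close> add up to at least the two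
    thresholds in \<open>r\<^sub>\<alpha>\<close>, so one of them reaches its own. The implication
    is asked almost everywhere because the tie condition holds only so.\<close>
  have typeI: "measure M A \<le> \<alpha>"
    if "AE \<omega> in M. \<omega> \<in> A \<longrightarrow> S \<omega> \<ge> r\<^sub>\<alpha> \<omega>" for A
  proof -
    have "AE \<omega> in M. \<omega> \<in> A \<longrightarrow> \<omega> \<in> {\<omega> \<in> space M. S \<omega> - E \<ge> ?\<tau> \<alpha>\<^sub>1 \<or> (-1) * (m \<omega> - E) \<ge> \<rho> * ?\<tau> \<alpha>\<^sub>2}"
      using that AE_space by eventually_elim (use r in auto)
    then have "prob A \<le> prob {\<omega> \<in> space M. S \<omega> - E \<ge> ?\<tau> \<alpha>\<^sub>1 \<or> (-1) * (m \<omega> - E) \<ge> \<rho> * ?\<tau> \<alpha>\<^sub>2}"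
      by (rule finite_measure_mono_AE) measurable
    also have "\<dots> \<le> \<alpha>\<^sub>1 + \<alpha>\<^sub>2"
      using \<open>\<alpha>\<^sub>1 > 0\<close> \<open>\<alpha>\<^sub>2 > 0\<close> \<open>\<alpha>\<^sub>1 + \<alpha>\<^sub>2 = \<alpha>\<close> \<open>\<alpha> < 1\<close> by (intro union) auto
    finally show ?thesis using \<open>\<alpha>\<^sub>1 + \<alpha>\<^sub>2 = \<alpha>\<close> by simp
  qed
  show ?thesis
  proof (intro conjI impI allI)
    assume star: "h \<theta>star \<in> \<Omega>"
    have gt: "S \<omega> > r\<^sub>\<alpha> \<omega>" if "\<omega> \<in> space M" "Psi q g V X (Y \<omega>) (\<theta>hat \<omega>) > r\<^sub>\<alpha> \<omega>" for \<omega>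
      using optimal_solution_gt[OF optimal[OF that(1)] star that(2)] Psi_star[OF that(1)] by simp
    show "measure M {\<omega> \<in> space M. Psi q g V X (Y \<omega>) (\<theta>hat \<omega>) > r\<^sub>\<alpha> \<omega>} \<le> \<alpha>"
      by (intro typeI AE_I2) (use gt in \<open>auto intro: less_imp_le\<close>)
    assume "AE \<omega> in M. no_avoidable_tie (Psi q g V X (Y \<omega>)) (r\<^sub>\<alpha> \<omega>) (null_params h \<Omega>) (\<theta>hat \<omega>)"
    then have "AE \<omega> in M. \<omega> \<in> {\<omega> \<in> space M. Psi q g V X (Y \<omega>) (\<theta>hat \<omega>) \<ge> r\<^sub>\<alpha> \<omega>} \<longrightarrow> S \<omega> \<ge> r\<^sub>\<alpha> \<omega>"
    proof eventually_elim
      case (elim \<omega>)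
      show ?case
      proof (intro impI)
        assume "\<omega> \<in> {\<omega> \<in> space M. Psi q g V X (Y \<omega>) (\<theta>hat \<omega>) \<ge> r\<^sub>\<alpha> \<omega>}"
        then consider "\<omega> \<in> space M" "Psi q g V X (Y \<omega>) (\<theta>hat \<omega>) > r\<^sub>\<alpha> \<omega>"
          | "\<omega> \<in> space M" "Psi q g V X (Y \<omega>) (\<theta>hat \<omega>) = r\<^sub>\<alpha> \<omega>"
          by fastforce
        then show "S \<omega> \<ge> r\<^sub>\<alpha> \<omega>"
        proof cases
          case 1
          then show ?thesis using gt by fastforce
        next
          \<comment> \<open>A tie is settled by \<open>no_avoidable_tie\<close> with \<theta>star as
            the null parameter: its value of \<open>Psi\<close>, which is \<open>S \<omega>\<close>,
            cannot be below the threshold.\<close>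
          case 2
          then show ?thesis
            using elim star Psi_star[OF 2(1)] by (auto simp: no_avoidable_tie_def null_params_def)
        qed
      qed
    qed
    then show "measure M {\<omega> \<in> space M. Psi q g V X (Y \<omega>) (\<theta>hat \<omega>) \<ge> r\<^sub>\<alpha> \<omega>} \<le> \<alpha>"
      by (rule typeI)
  next
    fix \<beta> \<beta>\<^sub>1 \<beta>\<^sub>2 :: real
    assume \<beta>: "\<beta>\<^sub>1 > 0" "\<beta>\<^sub>2 > 0" "\<beta>\<^sub>1 + \<beta>\<^sub>2 = \<beta>" "\<beta> < 1"
    let ?D = "\<lambda>\<theta>. lq_norm q ((1 / real CARD('n)) *\<^sub>R (\<Sum>i\<in>UNIV. (g (V $ i) \<theta>star - g (V $ i) \<theta>) *\<^sub>R X $ i))"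
    assume sep: "(INF \<theta>\<in>null_params h \<Omega>. ?D \<theta>) \<ge> separation M W \<sigma> q X CARD('r) \<alpha>\<^sub>1 \<alpha>\<^sub>2 \<beta>\<^sub>1 \<beta>\<^sub>2"
    have "{\<omega> \<in> space M. Psi q g V X (Y \<omega>) (\<theta>hat \<omega>) \<le> r\<^sub>\<alpha> \<omega>} \<subseteq>
      {\<omega> \<in> space M. S \<omega> - E \<ge> ?\<tau> \<beta>\<^sub>2 \<or> 1 * (m \<omega> - E) \<ge> \<rho> * ?\<tau> \<beta>\<^sub>1}"
    proof safe
      fix \<omega>
      assume \<omega>: "\<omega> \<in> space M" and le: "Psi q g V X (Y \<omega>) (\<theta>hat \<omega>) \<le> r\<^sub>\<alpha> \<omega>"
        and nm: "\<not> \<rho> * ?\<tau> \<beta>\<^sub>1 \<le> 1 * (m \<omega> - E)"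
      have "\<theta>hat \<omega> \<in> null_params h \<Omega>"
        using optimal[OF \<omega>] by (auto simp: optimal_solution_def is_arg_min_def null_params_def)
      then have "(INF \<theta>\<in>null_params h \<Omega>. ?D \<theta>) \<le> ?D (\<theta>hat \<omega>)"
        by (intro cINF_lower bdd_belowI2[of _ 0] lq_norm_nonneg)
      also have "?D (\<theta>hat \<omega>) \<le> Psi q g V X (Y \<omega>) (\<theta>hat \<omega>) + S \<omega>"
      proof -
        \<comment> \<open>By the model, the increment of \<open>g\<close> between \<theta>star and
          \<theta>hat is the residual at \<theta>hat minus the noise.\<close>
        have "(1 / real CARD('n)) *\<^sub>R (\<Sum>i\<in>UNIV. (g (V $ i) \<theta>star - g (V $ i) (\<theta>hat \<omega>)) *\<^sub>R X $ i) =
          (1 / real CARD('n)) *\<^sub>R (\<Sum>i\<in>UNIV. (Y \<omega> $ i - g (V $ i) (\<theta>hat \<omega>)) *\<^sub>R X $ i)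
            + - ((1 / real CARD('n)) *\<^sub>R (transpose X *v W \<omega>))"
          unfolding transpose_mult_vec model[OF \<omega>]
          by (simp add: scaleR_diff_right[symmetric] sum_subtractf[symmetric] scaleR_diff_left[symmetric]
              del: scaleR_right.diff)
        then show ?thesis
          unfolding Psi_def S_def score_norm_def
          using lq_norm_triangle[OF q, of "(1 / real CARD('n)) *\<^sub>R (\<Sum>i\<in>UNIV. (Y \<omega> $ i - g (V $ i) (\<theta>hat \<omega>)) *\<^sub>R X $ i)"
              "- ((1 / real CARD('n)) *\<^sub>R (transpose X *v W \<omega>))"]
          by (simp only: lq_norm_minus)
      qed
      finally have "separation M W \<sigma> q X CARD('r) \<alpha>\<^sub>1 \<alpha>\<^sub>2 \<beta>\<^sub>1 \<beta>\<^sub>2 \<le> r\<^sub>\<alpha> \<omega> + S \<omega>"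
        using sep le by linarith
      \<comment> \<open>The two \<alpha>-terms of the separation cancel against those of
        \<open>r\<^sub>\<alpha>\<close>, leaving \<open>m \<omega> + S \<omega>\<close> at least
        \<open>2 * E\<close> plus the two \<beta>-terms. As \<open>m \<omega> - E\<close> stays
        below its threshold, \<open>S \<omega> - E\<close> must reach its own; one copy of
        \<open>E\<close> centres each statistic.\<close>
      then show "?\<tau> \<beta>\<^sub>2 \<le> S \<omega> - E"
        using nm unfolding r[OF \<omega>] separation_def E_def[unfolded S_def, symmetric] \<rho>_def[symmetric] by simp
    qed
    then have "measure M {\<omega> \<in> space M. Psi q g V X (Y \<omega>) (\<theta>hat \<omega>) \<le> r\<^sub>\<alpha> \<omega>} \<le>
      prob {\<omega> \<in> space M. S \<omega> - E \<ge> ?\<tau> \<beta>\<^sub>2 \<or> 1 * (m \<omega> - E) \<ge> \<rho> * ?\<tau> \<beta>\<^sub>1}"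
      by (rule finite_measure_mono) measurable
    also have "\<dots> \<le> \<beta>\<^sub>2 + \<beta>\<^sub>1"
      using \<beta> by (intro union) auto
    finally show "measure M {\<omega> \<in> space M. Psi q g V X (Y \<omega>) (\<theta>hat \<omega>) \<le> r\<^sub>\<alpha> \<omega>} \<le> \<beta>"
      using \<beta> by simp
  qed
qed

end
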